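(* Let $(P)$ be the problem in the context. Suppose that Assumption (S) (structure) and the constraint qualification $\mathbf{CQ}$ from the context hold. Suppose further that $f(x)=f_0(x)+\delta_{\Xi}(x)$ and $g(y)=g_0(y)+\delta_{\Delta}(y)$, where $\Xi\subseteq\mathcal{E}_1$ and $\Delta\subseteq\mathcal{E}_2$ are compact convex sets and $f_0$ and $g_0$ are real-valued convex functions. Let $F(x,y)=f(x)+g(y)+\delta_{\{c\}}(Ax+By)$ and let $\{(x^t,y^t)\}$ be generated by the algorithm in the context. If $F$ is a KL function with exponent $\alpha\in[0,1)$, then $$\operatorname{dist}\left((x^t,y^t),\operatorname{Argmin}F\right)=\mathcal{O}\left((t+1)^{-(1-\alpha)\min\{\varpi_1,\varpi_2\}}\right),$$ where $\varpi_1=\min\{1-\delta,\nu,\mu\}$ and $\varpi_2=\min\left\{\delta,\frac12,\frac{\nu+\delta}{2},\frac{\mu+\delta}{2}\right\}$.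
   Context: Problem $(P)$: $\min_{x\in\mathcal{E}_1,y\in\mathcal{E}_2} f(x)+g(y)$ subject to $Ax+By=c$, where $\mathcal{E},\mathcal{E}_1,\mathcal{E}_2$ are finite dimensional (real) Hilbert spaces, $c\in\mathcal{E}$, $A:\mathcal{E}_1\to\mathcal{E}$ and $B:\mathcal{E}_2\to\mathcal{E}$ are linear, $f:\mathcal{E}_1\to(-\infty,\infty]$ and $g:\mathcal{E}_2\to(-\infty,\infty]$ are proper closed convex, and the solution set is nonempty. $A^*$ is the adjoint, $\lambda_{\max}$ the largest eigenvalue, $\partial$ the convex subdifferential, $\operatorname{dom}$ the effective domain, $\mathrm{ri}$ the relative interior, $\delta_C$ the indicator function of $C$ ($0$ on $C$, $\infty$ elsewhere), $\operatorname{Argmin}$ the set of minimizers, $\operatorname{dist}(x,C)=\inf_{y\in C}\|x-y\|$. Big-$\mathcal{O}$ is as $t\to\infty$, with constants independent of $t$. The scalar $\delta$ without subscript is the algorithm parameter. $\mathbf{CQ}$: $c\in A\,\mathrm{ri}(\operatorname{dom}f)+B\,\mathrm{ri}(\operatorname{dom}g)$. Assumption (S): $f=f_1+f_2$, $g=g_1+g_2$ with $f_1:\mathcal{E}_1\to\mathbb{R}$, $g_1:\mathcal{E}_2\to\mathbb{R}$ convex and smooth, $f_2:\mathcal{E}_1\to(-\infty,\infty]$, $g_2:\mathcal{E}_2\to(-\infty,\infty]$ proper closed convex; $\nabla f_1$ and $\nabla g_1$ are Hölder continuous on $\operatorname{dom}f$ and $\operatorname{dom}g$ respectively, and $\mu,\nu\in(0,1]$,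 $M_f,M_g\ge0$ are constants such that $f_1(y)\le f_1(x)+\langle\nabla f_1(x),y-x\rangle+\frac{M_f}{\mu+1}\|y-x\|^{\mu+1}$ for all $x,y\in\operatorname{dom}f$, and $g_1(y)\le g_1(x)+\langle\nabla g_1(x),y-x\rangle+\frac{M_g}{\nu+1}\|y-x\|^{\nu+1}$ for all $x,y\in\operatorname{dom}g$; and for every $v\in\mathcal{E}_2$ a minimizer of $y\mapsto\langle v,y\rangle+g_2(y)$ over $\mathcal{E}_2$ exists. (The paper also assumes that these minimizers and the proximal mappings of $\gamma f_2$, $\gamma>0$, can be computed efficiently.) Algorithm: choose $x^0\in\operatorname{dom}f$, $y^0\in\operatorname{dom}g$, $\beta_0>0$, $H_0>0$, $\delta\in(0,1)$; let $\lambda_A=\lambda_{\max}(A^*A)$. For $t=0,1,\dots$, with $\alpha_t=\frac{2}{t+2}$: $R^t=Ax^t+By^t-c$; $x^{t+1}=\arg\min_{x}\ \langle\nabla f_1(x^t)+\beta_tA^*R^t,x-x^t\rangle+\frac{H_t+\lambda_A\beta_t}{2}\|x-x^t\|^2+f_2(x)$; $\widetilde R^t=Ax^{t+1}+By^t-c$; $u^t\in\operatorname{Argmin}_{y}\ \langle\nabla g_1(y^t)+\beta_tB^*\widetilde R^t,y\rangle+g_2(y)$ (any minimizer); $y^{t+1}=y^t+\alpha_t(u^t-y^t)$; $H_{t+1}=\max\{H_0,\frac{2M_f}{\mu+1}\}(t+1)^{1-\mu}$, $\beta_{t+1}=\beta_0(t+2)^{\delta}$ (so $\beta_t=\beta_0(t+1)^\delta$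 for all $t\ge0$). KL functions: a proper closed convex function $F$ satisfies the KL property with exponent $\alpha\in[0,1)$ at $\bar z\in\operatorname{dom}\partial F=\{z:\partial F(z)\neq\emptyset\}$ if there exist $r\in(0,\infty]$, $\rho>0$ and a neighborhood $U$ of $\bar z$ such that, with $\phi(s)=\rho s^{1-\alpha}$ on $[0,r)$, one has $\phi'(F(z)-F(\bar z))\operatorname{dist}(0,\partial F(z))\ge1$ for all $z\in U$ with $F(\bar z)<F(z)<F(\bar z)+r$ (with $\operatorname{dist}(0,\emptyset)=\infty$). $F$ is a KL function with exponent $\alpha$ if this holds at every point of $\operatorname{dom}\partial F$. *)

theory Defs
  imports "HOL-Analysis.Analysis" "HOL-Library.Landau_Symbols"
begin

definition edom :: "('a \<Rightarrow> ereal) \<Rightarrow> 'a set" where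
  "edom f = {x. f x < \<infinity>}"

definition ext_epigraph :: "('a \<Rightarrow> ereal) \<Rightarrow> ('a \<times> real) set" where
  "ext_epigraph f = {(x, r). f x \<le> ereal r}"

definition proper_closed_convex :: "('a::euclidean_space \<Rightarrow> ereal) \<Rightarrow> bool" where
  "proper_closed_convex f \<longleftrightarrow>
     (\<forall>x. f x \<noteq> -\<infinity>) \<and> edom f \<noteq> {} \<and> closed (ext_epigraph f) \<and> convex (ext_epigraph f)"

text \<open>The indicator function of convex analysis, unlike the 0/1-valued
  \<^const>\<open>indicator\<close>.\<close>

definition ext_indicator :: "'a set \<Rightarrow> 'a \<Rightarrow> ereal" where
  "ext_indicator C x = (if x \<in> C then 0 else \<infinity>)"

definition Argmin :: "('a \<Rightarrow> ereal) \<Rightarrow> 'a set" where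
  "Argmin f = {x. is_arg_min f (\<lambda>_. True) x}"

definition subdifferential :: "('a::euclidean_space \<Rightarrow> ereal) \<Rightarrow> 'a \<Rightarrow> 'a set" where
  "subdifferential f x = {v. x \<in> edom f \<and> (\<forall>y. f y \<ge> f x + ereal (v \<bullet> (y - x)))}"

text \<open>In contrast to \<^const>\<open>infdist\<close>, the distance to the empty set is \<open>\<infinity>\<close>.\<close>

definition ext_infdist :: "'a::metric_space \<Rightarrow> 'a set \<Rightarrow> ereal" where
  "ext_infdist x C = (INF y\<in>C. ereal (dist x y))"

text \<open>The desingularizing function \<open>\<lambda>s. \<rho> * s powr (1 - \<alpha>)\<close> is only differentiated at
  points of the open interval from \<open>0\<close> to \<open>r\<close>, so its values elsewhere are irrelevant.\<close>

definition KL_at :: "('a::euclidean_space \<Rightarrow> ereal) \<Rightarrow> real \<Rightarrow> 'a \<Rightarrow> bool" where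
  "KL_at F \<alpha> zb \<longleftrightarrow>
     (\<exists>r::ereal. \<exists>\<rho>::real. \<exists>U. r > 0 \<and> \<rho> > 0 \<and> open U \<and> zb \<in> U \<and>
       (\<forall>z\<in>U. F zb < F z \<and> F z < F zb + r \<longrightarrow>
          ereal (deriv (\<lambda>s. \<rho> * s powr (1 - \<alpha>)) (real_of_ereal (F z - F zb)))
            * ext_infdist 0 (subdifferential F z) \<ge> 1))"

definition KL_function :: "('a::euclidean_space \<Rightarrow> ereal) \<Rightarrow> real \<Rightarrow> bool" where
  "KL_function F \<alpha> \<longleftrightarrow> (\<forall>zb. subdifferential F zb \<noteq> {} \<longrightarrow> KL_at F \<alpha> zb)"

definition holder_continuous_on ::
  "'a::real_normed_vector set \<Rightarrow> ('a \<Rightarrow> 'b::real_normed_vector) \<Rightarrow> bool" where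
  "holder_continuous_on S G \<longleftrightarrow>
     (\<exists>\<kappa> L. 0 < \<kappa> \<and> \<kappa> \<le> 1 \<and> 0 \<le> L \<and>
        (\<forall>x\<in>S. \<forall>y\<in>S. norm (G x - G y) \<le> L * norm (x - y) powr \<kappa>))"

text \<open>Only used for self-adjoint \<open>T\<close>, where the set of real eigenvalues is finite and nonempty.\<close>

definition lambda_max :: "('a::euclidean_space \<Rightarrow> 'a) \<Rightarrow> real" where
  "lambda_max T = Max {l. \<exists>v. v \<noteq> 0 \<and> T v = l *\<^sub>R v}"

end

theory Submission
  imports Defs
begin

text \<open>
  With \<open>E t\<close> the objective gap plus the quadratic penalty of the constraint residual, weighted by
  \<open>\<beta>\<close> at the preceding index, one sweep of the algorithm gives
  \<open>E (t + 1) \<le> t / (t + 2) * E t + C * (t + 1) powr (- (1 + \<omega>1))\<close>, hence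
  \<open>E t \<le> K * (t + 1) powr (- \<omega>1)\<close>. The constraint qualification makes the distance to the feasible
  set at most a multiple of the residual, so the objective gap at an infeasible point is bounded below
  by a multiple of the residual, and the bound on \<open>E t\<close> forces the residual to be of order
  \<open>(t + 1) powr (- \<omega>2)\<close>. A feasible point this close to the iterate therefore has objective gap of order
  \<open>(t + 1) powr (- min \<omega>1 \<omega>2)\<close>. Finally the KL inequality yields the error bound
  \<open>dist(z, Argmin F) \<le> C * (F z - min F) powr (1 - \<alpha>)\<close>: a minimizer \<open>w\<close> of
  \<open>(F w - min F) powr (1 - \<alpha>) + \<sigma> * norm (w - z)\<close> with small \<open>\<sigma>\<close> that is not in \<open>Argmin F\<close> would have
  a subgradient too short for the KL inequality.
\<close>

subsection \<open>Convex analysis\<close>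

text \<open>On the line through \<open>x\<close> and \<open>y\<close> the function is convex in one
  real variable, and the one-dimensional tangent inequality, taken between the parameters
  \<open>0\<close> and \<open>1\<close>, is the claim.\<close>

lemma convex_on_above_gradient:
  fixes f :: "'a::euclidean_space \<Rightarrow> real"
  assumes "convex_on UNIV f" "GDERIV f x :> D"
  shows "f x + D \<bullet> (y - x) \<le> f y"
proof -
  define \<phi> where "\<phi> s = f (x + s *\<^sub>R (y - x))" for s :: real
  have "convex_on UNIV \<phi>"
  proof (intro convex_onI)
    fix t r s :: real
    assume t: "0 < t" "t < 1"
    have "x + ((1 - t) *\<^sub>R r + t *\<^sub>R s) *\<^sub>R (y - x)
        = (1 - t) *\<^sub>R (x + r *\<^sub>R (y - x)) + t *\<^sub>R (x + s *\<^sub>R (y - x))"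
      by (simp add: algebra_simps)
    then show "\<phi> ((1 - t) *\<^sub>R r + t *\<^sub>R s) \<le> (1 - t) * \<phi> r + t * \<phi> s"
      unfolding \<phi>_def using convex_onD[OF assms(1), of t] t by simp
  qed simp
  moreover have "(\<phi> has_real_derivative D \<bullet> (y - x)) (at 0)"
  proof -
    have "((\<lambda>s. x + s *\<^sub>R (y - x)) has_derivative (\<lambda>s. s *\<^sub>R (y - x))) (at 0)"
      by (auto intro!: derivative_eq_intros)
    moreover have "(f has_derivative (\<lambda>h. h \<bullet> D)) (at (x + 0 *\<^sub>R (y - x)))"
      using assms(2) by (simp add: gderiv_def)
    ultimately have "(\<phi> has_derivative (\<lambda>s. (s *\<^sub>R (y - x)) \<bullet> D)) (at 0)"
      unfolding \<phi>_def by (rule has_derivative_compose)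
    then show ?thesis
      by (simp add: has_field_derivative_def inner_commute mult.commute[of _ "_ \<bullet> _"])
  qed
  ultimately have "\<phi> 1 - \<phi> 0 \<ge> D \<bullet> (y - x) * (1 - 0)"
    by (intro convex_on_imp_above_tangent[where A = UNIV]) auto
  then show ?thesis by (simp add: \<phi>_def)
qed

text \<open>Eigenvectors for different eigenvalues are orthogonal, so one eigenvector per eigenvalue
  gives an independent set, which is finite in finite dimension. This makes the \<open>Max\<close>
  in \<open>lambda_max\<close> meaningful.\<close>

lemma eigenvalues_selfadjoint_finite:
  fixes T :: "'a::euclidean_space \<Rightarrow> 'a"
  assumes "\<And>v w. T v \<bullet> w = v \<bullet> T w"
  shows "finite {l. \<exists>v. v \<noteq> 0 \<and> T v = l *\<^sub>R v}"
proof -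
  define E where "E = {l. \<exists>v. v \<noteq> 0 \<and> T v = l *\<^sub>R v}"
  have "\<forall>l\<in>E. \<exists>v. v \<noteq> 0 \<and> T v = l *\<^sub>R v" by (simp add: E_def)
  then obtain e where e: "\<And>l. l \<in> E \<Longrightarrow> e l \<noteq> 0" "\<And>l. l \<in> E \<Longrightarrow> T (e l) = l *\<^sub>R e l"
    by metis
  have orth: "e l \<bullet> e k = 0" if "l \<in> E" "k \<in> E" "l \<noteq> k" for l k
    using assms[of "e l" "e k"] e(2)[OF that(1)] e(2)[OF that(2)] that(3) by simp
  have "inj_on e E"
  proof (rule inj_onI, rule ccontr)
    fix l k assume "l \<in> E" "k \<in> E" "e l = e k" "l \<noteq> k"
    then show False using orth[of l k] e(1)[of k] by simp
  qed
  moreover have "independent (e ` E)"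
  proof (rule pairwise_orthogonal_independent)
    show "pairwise orthogonal (e ` E)"
      using orth by (auto simp: pairwise_def orthogonal_def)
    show "0 \<notin> e ` E" using e(1) by force
  qed
  ultimately show ?thesis
    using independent_imp_finite finite_imageD unfolding E_def by blast
qed

text \<open>The maximum \<open>m\<close> of \<open>(norm (A v))\<^sup>2\<close> over the unit sphere
  is attained, and a maximizer is an eigenvector of \<open>adjoint A \<circ> A\<close> for
  \<open>m\<close>; hence \<open>m\<close> is among the eigenvalues over which
  \<open>lambda_max\<close> is taken.\<close>

lemma norm_linear_le_lambda_max:
  fixes A :: "'a::euclidean_space \<Rightarrow> 'c::euclidean_space"
  assumes "linear A"
  shows "(norm (A h))\<^sup>2 \<le> lambda_max (adjoint A \<circ> A) * (norm h)\<^sup>2"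
proof -
  define T where "T = adjoint A \<circ> A"
  have T: "v \<bullet> T w = A v \<bullet> A w" for v w
    by (simp add: T_def adjoint_works[OF assms])
  have "compact (sphere (0::'a) 1)" "sphere (0::'a) 1 \<noteq> {}" by auto
  moreover have "continuous_on (sphere 0 1) (\<lambda>v. (norm (A v))\<^sup>2)"
    by (intro continuous_intros linear_continuous_on linear_conv_bounded_linear[THEN iffD1] assms)
  ultimately obtain v where v: "norm v = 1" "\<And>w. norm w = 1 \<Longrightarrow> (norm (A w))\<^sup>2 \<le> (norm (A v))\<^sup>2"
    using continuous_attains_sup[of "sphere (0::'a) 1" "\<lambda>v. (norm (A v))\<^sup>2"] by auto
  define m where "m = (norm (A v))\<^sup>2"
  have bound: "(norm (A w))\<^sup>2 \<le> m * (norm w)\<^sup>2" for w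
  proof (cases "w = 0")
    case False
    then have "(norm (A (w /\<^sub>R norm w)))\<^sup>2 \<le> m" unfolding m_def by (intro v(2)) simp
    then show ?thesis
      using False by (simp add: linear_scale[OF assms] power_mult_distrib power_divide field_simps)
  qed (simp add: linear_0[OF assms])
  have "T v = m *\<^sub>R v"
  proof (rule ccontr)
    \<comment> \<open>If the eigenvector residual \<open>w\<close> were nonzero, moving from
      \<open>v\<close> along \<open>w\<close> would violate \<open>bound\<close> to first order in
      the step \<open>s\<close>.\<close>
    define w where "w = T v - m *\<^sub>R v"
    assume "T v \<noteq> m *\<^sub>R v"
    then have w: "norm w > 0" by (simp add: w_def)
    define Q where "Q = m * (norm w)\<^sup>2 - (norm (A w))\<^sup>2"
    have Q: "Q \<ge> 0" using bound[of w] by (simp add: Q_def)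
    have vw: "A v \<bullet> A w - m * (v \<bullet> w) = (norm w)\<^sup>2"
    proof -
      have "(norm w)\<^sup>2 = w \<bullet> T v - m * (w \<bullet> v)"
        by (simp add: w_def power2_norm_eq_inner inner_diff_right)
      then show ?thesis by (simp only: T) (simp add: inner_commute)
    qed
    have *: "2 * s * (norm w)\<^sup>2 \<le> s\<^sup>2 * Q" for s
    proof -
      have "(norm (A (v + s *\<^sub>R w)))\<^sup>2 \<le> m * (norm (v + s *\<^sub>R w))\<^sup>2" by (rule bound)
      moreover have "(norm (A (v + s *\<^sub>R w)))\<^sup>2 = m + 2 * s * (A v \<bullet> A w) + s\<^sup>2 * (norm (A w))\<^sup>2"
        unfolding m_def power2_norm_eq_inner
        by (simp add: linear_add[OF assms] linear_scale[OF assms]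
            algebra_simps inner_commute power2_eq_square)
      moreover have "(norm (v + s *\<^sub>R w))\<^sup>2 = 1 + 2 * s * (v \<bullet> w) + s\<^sup>2 * (norm w)\<^sup>2"
        unfolding power2_norm_eq_inner using v(1)
        by (simp add: norm_eq_1
            algebra_simps inner_commute power2_eq_square)
      ultimately have "2 * s * (A v \<bullet> A w - m * (v \<bullet> w)) \<le> s\<^sup>2 * Q"
        by (simp add: Q_def algebra_simps)
      then show ?thesis by (simp add: vw)
    qed
    have "2 * (norm w)\<^sup>2 \<le> s * Q" if "s > 0" for s
      using *[of s] that by (simp add: power2_eq_square)
    \<comment> \<open>This step length keeps \<open>s * Q\<close> at or below
      \<open>(norm w)\<^sup>2\<close>, although it would have to reach twice that value.\<close>
    from this[of "(norm w)\<^sup>2 / (Q + 1)"] have "2 * (norm w)\<^sup>2 \<le> (norm w)\<^sup>2 * (Q / (Q + 1))"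
      using Q w by simp
    also have "\<dots> \<le> (norm w)\<^sup>2 * 1" using Q by (intro mult_left_mono) auto
    finally show False using w by simp
  qed
  moreover have "v \<noteq> 0" using v(1) by auto
  ultimately have "m \<in> {l. \<exists>v. v \<noteq> 0 \<and> T v = l *\<^sub>R v}" by blast
  moreover have "finite {l. \<exists>v. v \<noteq> 0 \<and> T v = l *\<^sub>R v}"
    by (rule eigenvalues_selfadjoint_finite) (simp add: T inner_commute[of "T _"] inner_commute)
  ultimately have "m \<le> lambda_max T" by (simp add: lambda_max_def)
  then show ?thesis
    using bound[of h] mult_right_mono[of m "lambda_max T" "(norm h)\<^sup>2"] unfolding T_def by simp
qed

text \<open>The segment from \<open>x\<close> to \<open>y\<close> is prolonged by one unit beyond
  \<open>y\<close> to a point \<open>z\<close> of a slightly larger ball. As \<open>y\<close> lies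
  between \<open>x\<close> and \<open>z\<close>, convexity and the bound for \<open>f\<close> on
  that ball control the slope.\<close>

lemma convex_on_lipschitz_on_bounded:
  fixes f :: "'a::euclidean_space \<Rightarrow> real"
  assumes "convex_on UNIV f" "bounded S"
  obtains L where "L \<ge> 0" "\<And>x y. x \<in> S \<Longrightarrow> y \<in> S \<Longrightarrow> f y - f x \<le> L * norm (y - x)"
proof -
  obtain r where r: "\<And>x. x \<in> S \<Longrightarrow> norm x \<le> r" using assms(2) by (auto simp: bounded_iff)
  have "continuous_on (cball 0 (r + 1)) f"
    using convex_on_continuous[OF open_UNIV assms(1)] continuous_on_subset by blast
  then have "bounded (f ` cball 0 (r + 1))"
    using compact_continuous_image compact_imp_bounded compact_cball by blast
  then obtain M where M: "\<And>x. norm x \<le> r + 1 \<Longrightarrow> \<bar>f x\<bar> \<le> M"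
    by (fastforce simp: bounded_iff)
  \<comment> \<open>An empty \<open>S\<close> admits a negative radius, and then \<open>M\<close>
    may be negative as well; hence the absolute value.\<close>
  have "f y - f x \<le> 2 * \<bar>M\<bar> * norm (y - x)" if "x \<in> S" "y \<in> S" for x y
  proof (cases "x = y")
    case False
    define d where "d = norm (y - x)"
    have d: "d > 0" using False by (simp add: d_def)
    define z where "z = y + (y - x) /\<^sub>R d"
    have "norm z \<le> norm y + norm ((y - x) /\<^sub>R d)" unfolding z_def by (rule norm_triangle_ineq)
    also have "norm ((y - x) /\<^sub>R d) = 1" using d by (simp add: d_def)
    finally have z: "norm z \<le> r + 1" using r[OF that(2)] by simp
    \<comment> \<open>The weight that \<open>z\<close> has in
      \<open>y = (1 - t) *\<^sub>R x + t *\<^sub>R z\<close>; being at most \<open>d\<close>, it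
      makes the bound proportional to the distance.\<close>
    define t where "t = d / (1 + d)"
    have t: "0 \<le> t" "t \<le> 1" "t \<le> d" using d by (auto simp: t_def field_simps)
    have "(1 - t) *\<^sub>R x + t *\<^sub>R z = x + t *\<^sub>R ((1 + 1 / d) *\<^sub>R (y - x))"
      by (simp add: z_def algebra_simps divide_inverse)
    also have "t *\<^sub>R ((1 + 1 / d) *\<^sub>R (y - x)) = y - x"
    proof -
      have "t * (1 + 1 / d) = 1"
        using d unfolding t_def by (simp add: divide_simps)
      then show ?thesis by (simp only: scaleR_scaleR) simp
    qed
    finally have "f y \<le> (1 - t) * f x + t * f z"
      using convex_onD[OF assms(1) t(1,2), of x z] by simp
    then have "f y - f x \<le> t * (f z - f x)" by (simp add: algebra_simps)
    also have "\<dots> \<le> d * (2 * \<bar>M\<bar>)"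
    proof (cases "f z - f x \<ge> 0")
      case True
      then show ?thesis using t d M[OF z] M[of x] r[OF that(1)] by (intro mult_mono) auto
    next
      case False
      then have "t * (f z - f x) \<le> 0" using t by (intro mult_nonneg_nonpos) auto
      then show ?thesis using d by (smt (verit) mult_nonneg_nonneg)
    qed
    finally show ?thesis by (simp add: d_def mult.commute)
  qed simp
  then show ?thesis using that[of "2 * \<bar>M\<bar>"] by simp
qed

text \<open>Since \<open>c\<close> is a relative interior point of the image of \<open>D\<close>,
  the segment from \<open>L z\<close> to \<open>c\<close> can be prolonged by a fixed length
  \<open>e\<close> inside the image. A convex combination of \<open>z\<close> and a preimage of the
  far end is feasible, and its weight is proportional to the residual.\<close>

lemma linear_regularity:
  fixes L :: "'a::euclidean_space \<Rightarrow> 'c::euclidean_space"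
  assumes "linear L" "convex D" "bounded D" "z0 \<in> rel_interior D" "L z0 = c"
  obtains C where "C \<ge> 0"
    "\<And>z. z \<in> D \<Longrightarrow> \<exists>z'\<in>D. L z' = c \<and> norm (z - z') \<le> C * norm (L z - c)"
proof -
  have "c \<in> L ` rel_interior D" using assms by blast
  then have "c \<in> rel_interior (L ` D)"
    using rel_interior_convex_linear_image[OF assms(1,2)] by simp
  then obtain e where e: "e > 0" "cball c e \<inter> affine hull (L ` D) \<subseteq> L ` D" and cD: "c \<in> L ` D"
    by (auto simp: mem_rel_interior_cball)
  obtain M where M: "\<And>z w. z \<in> D \<Longrightarrow> w \<in> D \<Longrightarrow> norm (z - w) \<le> M"
    using diameter_bounded_bound[OF assms(3)] unfolding dist_norm by blast
  have "\<exists>z'\<in>D. L z' = c \<and> norm (z - z') \<le> \<bar>M\<bar> / e * norm (L z - c)" if z: "z \<in> D" for z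
  proof (cases "L z = c")
    case True
    then show ?thesis using z by force
  next
    case False
    define d where "d = norm (L z - c)"
    have d: "d > 0" using False by (simp add: d_def)
    \<comment> \<open>The point at distance \<open>e\<close> beyond \<open>c\<close> on the ray from
      \<open>L z\<close> through \<open>c\<close>.\<close>
    define p where "p = c - (e / d) *\<^sub>R (L z - c)"
    have "p = (1 + e / d) *\<^sub>R c + (- (e / d)) *\<^sub>R L z" by (simp add: p_def algebra_simps)
    moreover have "(1 + e / d) *\<^sub>R c + (- (e / d)) *\<^sub>R L z \<in> affine hull (L ` D)"
      using z cD by (intro mem_affine affine_affine_hull hull_inc) auto
    moreover have "dist c p = e" using d e by (simp add: p_def dist_norm d_def)
    ultimately have "p \<in> L ` D" using e by auto
    then obtain w where w: "w \<in> D" "L w = p" by blast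
    \<comment> \<open>The weight for which \<open>(1 - s) *\<^sub>R L z + s *\<^sub>R p\<close>
      equals \<open>c\<close>.\<close>
    define s where "s = d / (e + d)"
    have s: "0 \<le> s" "s \<le> 1" using d e by (auto simp: s_def)
    define z' where "z' = (1 - s) *\<^sub>R z + s *\<^sub>R w"
    have z'D: "z' \<in> D" unfolding z'_def using s z w(1) by (intro convexD[OF assms(2)]) auto
    have "L z' = (1 - s) *\<^sub>R L z + s *\<^sub>R p"
      by (simp add: z'_def linear_add[OF assms(1)] linear_scale[OF assms(1)] w)
    also have "\<dots> = c + (1 - s - s * (e / d)) *\<^sub>R (L z - c)"
      by (simp add: p_def algebra_simps)
    also have "1 - s - s * (e / d) = 0" using d e by (simp add: s_def divide_simps)
    finally have "L z' = c" by simp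
    moreover have "norm (z - z') = s * norm (z - w)"
    proof -
      have "z - z' = s *\<^sub>R (z - w)" by (simp add: z'_def algebra_simps)
      then show ?thesis using s by simp
    qed
    moreover have "s * norm (z - w) \<le> (d / e) * \<bar>M\<bar>"
      using M[OF z w(1)] d e by (intro mult_mono) (auto simp: s_def intro!: divide_left_mono)
    ultimately show ?thesis using z'D by (force simp: d_def mult.commute)
  qed
  then show ?thesis using that[of "\<bar>M\<bar> / e"] e(1) by simp
qed

text \<open>A hyperplane separates the epigraph of \<open>\<phi>\<close> from the strict hypograph
  of the cone \<open>\<phi> w - \<tau> * norm (z - w)\<close> and passes through their common
  boundary point over \<open>w\<close>. Lying below the epigraph makes its slope \<open>v\<close> a
  subgradient relative to \<open>D\<close>; lying above the cone bounds
  \<open>norm v\<close>.\<close>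

lemma convex_on_subgradient_le:
  fixes \<phi> :: "'a::euclidean_space \<Rightarrow> real"
  assumes "convex_on D \<phi>" "w \<in> D" "\<tau> \<ge> 0"
    and min: "\<And>z. z \<in> D \<Longrightarrow> \<phi> w - \<tau> * norm (z - w) \<le> \<phi> z"
  obtains v where "norm v \<le> \<tau>" "\<And>z. z \<in> D \<Longrightarrow> \<phi> w + v \<bullet> (z - w) \<le> \<phi> z"
proof -
  define S where "S = epigraph D (\<lambda>z. \<phi> z)"
  define T where "T = {(z, r). r < \<phi> w - \<tau> * norm (z - w)}"
  have "convex S" using assms(1) by (simp add: S_def convex_epigraph)
  moreover have "convex T"
  proof -
    have *: "\<tau> * norm (u *\<^sub>R z + v *\<^sub>R z' - w) \<le> u * (\<tau> * norm (z - w)) + v * (\<tau> * norm (z' - w))"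
      if "0 \<le> u" "0 \<le> v" "u + v = 1" for u v :: real and z z' :: 'a
    proof -
      have "w = u *\<^sub>R w + v *\<^sub>R w" using that(3) by (metis scaleR_add_left scaleR_one)
      then have "u *\<^sub>R z + v *\<^sub>R z' - w = u *\<^sub>R (z - w) + v *\<^sub>R (z' - w)"
        by (metis (no_types) add_diff_add scaleR_diff_right)
      then have "norm (u *\<^sub>R z + v *\<^sub>R z' - w) \<le> u * norm (z - w) + v * norm (z' - w)"
        using norm_triangle_ineq[of "u *\<^sub>R (z - w)" "v *\<^sub>R (z' - w)"] that by simp
      then have "\<tau> * norm (u *\<^sub>R z + v *\<^sub>R z' - w) \<le> \<tau> * (u * norm (z - w) + v * norm (z' - w))"
        using assms(3) mult_left_mono by blast
      then show ?thesis by (simp add: algebra_simps)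
    qed
    show ?thesis
    proof (rule convexI, unfold T_def, clarsimp)
      fix z z' :: 'a and r r' u v :: real
      assume r: "r < \<phi> w - \<tau> * norm (z - w)" "r' < \<phi> w - \<tau> * norm (z' - w)"
        and uv: "0 \<le> u" "0 \<le> v" "u + v = 1"
      have "u * r + v * r' < u * (\<phi> w - \<tau> * norm (z - w)) + v * (\<phi> w - \<tau> * norm (z' - w))"
      proof (cases "u = 0")
        case False
        then have "u * r < u * (\<phi> w - \<tau> * norm (z - w))" using r uv by simp
        moreover have "v * r' \<le> v * (\<phi> w - \<tau> * norm (z' - w))" using r uv by (intro mult_left_mono) auto
        ultimately show ?thesis by simp
      qed (use r uv in simp)
      also have "\<dots> = \<phi> w - (u * (\<tau> * norm (z - w)) + v * (\<tau> * norm (z' - w)))"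
      proof -
        have v: "v = 1 - u" using uv(3) by simp
        show ?thesis unfolding v by (simp add: algebra_simps)
      qed
      also have "\<dots> \<le> \<phi> w - \<tau> * norm (u *\<^sub>R z + v *\<^sub>R z' - w)" using *[OF uv, of z z'] by simp
      finally show "u * r + v * r' < \<phi> w - \<tau> * norm (u *\<^sub>R z + v *\<^sub>R z' - w)" .
    qed
  qed
  moreover have "(w, \<phi> w) \<in> S" "(w, \<phi> w - 1) \<in> T" using assms(2) by (auto simp: S_def T_def epigraph_def)
  moreover have "S \<inter> T = {}" using min by (fastforce simp: S_def T_def epigraph_def)
  ultimately obtain a b where ab: "a \<noteq> 0" "\<And>z. z \<in> S \<Longrightarrow> a \<bullet> z \<le> b" "\<And>z. z \<in> T \<Longrightarrow> b \<le> a \<bullet> z"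
    using separating_hyperplane_sets[of S T] by blast
  obtain p q where pq: "a = (p, q)" by (cases a)
  have S: "p \<bullet> z + q * \<phi> z \<le> b" if "z \<in> D" for z
    using ab(2)[of "(z, \<phi> z)"] that by (simp add: pq S_def epigraph_def)
  have T: "b \<le> p \<bullet> z + q * (\<phi> w - \<tau> * norm (z - w) - s)" if "s > 0" for z s
    using ab(3)[of "(z, \<phi> w - \<tau> * norm (z - w) - s)"] that by (simp add: pq T_def)
  \<comment> \<open>The cone itself is not in \<open>T\<close>, whose defining inequality is strict;
    it is reached by letting \<open>s\<close> tend to \<open>0\<close>.\<close>
  have T': "b \<le> p \<bullet> z + q * (\<phi> w - \<tau> * norm (z - w))" for z
  proof (rule tendsto_lowerbound)
    show "((\<lambda>s. p \<bullet> z + q * (\<phi> w - \<tau> * norm (z - w) - s)) \<longlongrightarrow> p \<bullet> z + q * (\<phi> w - \<tau> * norm (z - w)))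
        (at_right 0)"
      by (rule tendsto_eq_intros refl | simp)+
    show "\<forall>\<^sub>F s in at_right 0. b \<le> p \<bullet> z + q * (\<phi> w - \<tau> * norm (z - w) - s)"
      using T by (auto simp: eventually_at_right_field intro: exI[of _ 1])
  qed simp
  have q: "q < 0"
  proof -
    have "q \<le> 0" using T[of 1 w] S[OF assms(2)] by (simp add: algebra_simps)
    \<comment> \<open>\<open>T\<close> has points over the whole space, so a vertical hyperplane
      would bound a linear form from below everywhere, which forces \<open>p = 0\<close>.\<close>
    moreover have False if "q = 0"
    proof -
      have "0 \<le> p \<bullet> (- p)" using T[of 1 "w - p"] S[OF assms(2)] that by (simp add: inner_diff_right)
      then have "p = 0" using inner_gt_zero_iff[of p] by (simp del: inner_gt_zero_iff)
      then show False using ab(1) that pq by (simp add: zero_prod_def)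
    qed
    ultimately show ?thesis by fastforce
  qed
  define v where "v = (- inverse q) *\<^sub>R p"
  have b: "b = p \<bullet> w + q * \<phi> w" using T'[of w] S[OF assms(2)] by simp
  have "\<phi> w + v \<bullet> (z - w) \<le> \<phi> z" if "z \<in> D" for z
    using S[OF that] q unfolding b v_def by (simp add: inner_diff_right field_simps)
  moreover have "norm v \<le> \<tau>"
  proof -
    \<comment> \<open>The cone condition is tested at \<open>w - v\<close>, the direction of
      steepest descent of the affine minorant.\<close>
    have "q * (\<tau> * norm v) \<le> p \<bullet> (- v)" using T'[of "w - v"] unfolding b by (simp add: algebra_simps)
    also have "p = (- q) *\<^sub>R v" using q by (simp add: v_def)
    also have "((- q) *\<^sub>R v) \<bullet> (- v) = q * (norm v * norm v)" by (simp add: dot_square_norm power2_eq_square)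
    finally have "norm v * norm v \<le> \<tau> * norm v" using q by simp
    then show ?thesis using assms(3) by (cases "v = 0") auto
  qed
  ultimately show ?thesis using that by blast
qed

subsection \<open>Error bound from the KL inequality\<close>

text \<open>The KL inequality in real terms: the derivative of the desingularizing function is
  \<open>\<rho> * (1 - \<alpha>) * s powr (- \<alpha>)\<close>, and its constant factor is moved
  into \<open>\<kappa>\<close>. An infinite radius is cut down to \<open>1\<close>.\<close>

lemma KL_at_subgradient_bound:
  assumes "KL_at F \<alpha> zb" "\<alpha> < 1" "F zb = ereal m"
  obtains r \<kappa> U where "r > 0" "\<kappa> > 0" "open U" "zb \<in> U"
    "\<And>z s v. z \<in> U \<Longrightarrow> F z = ereal s \<Longrightarrow> m < s \<Longrightarrow> s < m + r \<Longrightarrow> v \<in> subdifferential F z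
      \<Longrightarrow> \<kappa> * (s - m) powr \<alpha> \<le> norm v"
proof -
  obtain r :: ereal and \<rho> :: real and U where r: "r > 0" "\<rho> > 0" "open U" "zb \<in> U"
    and KL: "\<And>z. z \<in> U \<Longrightarrow> F zb < F z \<Longrightarrow> F z < F zb + r \<Longrightarrow>
       1 \<le> ereal (deriv (\<lambda>s. \<rho> * s powr (1 - \<alpha>)) (real_of_ereal (F z - F zb)))
            * ext_infdist 0 (subdifferential F z)"
    using assms(1) unfolding KL_at_def by blast
  obtain r' :: real where r': "r' > 0" "ereal r' \<le> r"
  proof (cases r)
    case (real r')
    then show ?thesis using r(1) that[of r'] by simp
  next
    case PInf
    then show ?thesis using that[of 1] by simp
  qed (use r(1) in simp)
  have "inverse (\<rho> * (1 - \<alpha>)) * (s - m) powr \<alpha> \<le> norm v"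
    if z: "z \<in> U" "F z = ereal s" "m < s" "s < m + r'" and v: "v \<in> subdifferential F z" for z s v
  proof -
    define d where "d = \<rho> * (1 - \<alpha>) * (s - m) powr (- \<alpha>)"
    have d: "d > 0" using r(2) assms(2) z(3) by (simp add: d_def)
    have "((\<lambda>s. \<rho> * s powr (1 - \<alpha>)) has_real_derivative d) (at (s - m))"
      unfolding d_def using z(3) by (auto intro!: derivative_eq_intros)
    then have der: "deriv (\<lambda>s. \<rho> * s powr (1 - \<alpha>)) (s - m) = d" by (rule DERIV_imp_deriv)
    have "ereal s < ereal m + ereal r'" using z(4) by simp
    also have "\<dots> \<le> ereal m + r" using r'(2) by (intro add_left_mono)
    finally have "1 \<le> ereal d * ext_infdist 0 (subdifferential F z)"
      using KL[OF z(1)] z(2,3) assms(3) der by simp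
    also have "\<dots> \<le> ereal d * ereal (norm v)"
    proof (rule ereal_mult_left_mono)
      have "ext_infdist 0 (subdifferential F z) \<le> ereal (dist 0 v)"
        unfolding ext_infdist_def using v by (rule INF_lower)
      then show "ext_infdist 0 (subdifferential F z) \<le> ereal (norm v)" by simp
    qed (use d in simp)
    finally have "1 \<le> d * norm v" by simp
    then show ?thesis
      using r(2) assms(2) z(3) by (simp add: d_def powr_minus field_simps)
  qed
  then show ?thesis using that[of r' "inverse (\<rho> * (1 - \<alpha>))" U] r r' assms(2) by simp
qed

text \<open>Compactness of \<open>D\<close> first makes the KL inequality uniform on a sublevel set.
  There the penalized minimization of \<open>G\<close>, in the manner of Ekeland's principle, turns
  the lower bound on subgradients into a distance bound. Outside the sublevel set the diameter of
  \<open>D\<close> suffices.\<close>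

lemma KL_error_bound:
  fixes F :: "'a::euclidean_space \<Rightarrow> ereal"
  assumes F: "\<And>z. F z = (if z \<in> D then ereal (\<phi> z) else \<infinity>)"
    and D: "compact D" and \<phi>: "convex_on D \<phi>" "continuous_on D \<phi>"
    and m: "\<And>z. z \<in> D \<Longrightarrow> m \<le> \<phi> z" "zs \<in> D" "\<phi> zs = m"
    and KL: "KL_function F \<alpha>" and \<alpha>: "0 \<le> \<alpha>" "\<alpha> < 1"
  obtains C where "C \<ge> 0"
    "\<And>z. z \<in> D \<Longrightarrow> infdist z (Argmin F) \<le> C * (\<phi> z - m) powr (1 - \<alpha>)"
proof -
  have Argmin: "Argmin F = {z \<in> D. \<phi> z = m}"
  proof -
    have "(\<nexists>y. F y < F z) \<longleftrightarrow> z \<in> D \<and> \<phi> z = m" for z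
      using m by (auto simp: F not_less dest: spec[of _ zs] intro!: antisym split: if_splits)
    then show ?thesis by (auto simp: Argmin_def is_arg_min_def)
  qed
  \<comment> \<open>If no uniform constants existed, violating points with values tending to
    \<open>m\<close> would accumulate at a minimizer, against the KL inequality there.\<close>
  have "\<exists>r>0. \<exists>\<kappa>>0. \<forall>z\<in>D. m < \<phi> z \<and> \<phi> z < m + r \<longrightarrow>
      (\<forall>v\<in>subdifferential F z. \<kappa> * (\<phi> z - m) powr \<alpha> \<le> norm v)"
  proof (rule ccontr)
    assume neg: "\<not> ?thesis"
    have "\<exists>z v. z \<in> D \<and> m < \<phi> z \<and> \<phi> z < m + 1 / real (Suc n) \<and> v \<in> subdifferential F z
        \<and> norm v < 1 / real (Suc n) * (\<phi> z - m) powr \<alpha>" for n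
    proof -
      have "1 / real (Suc n) > 0" by simp
      then show ?thesis using neg by (meson not_le)
    qed
    then obtain z v where z: "\<And>n. z n \<in> D" "\<And>n. m < \<phi> (z n)" "\<And>n. \<phi> (z n) < m + 1 / real (Suc n)"
      and v: "\<And>n. v n \<in> subdifferential F (z n)"
        "\<And>n. norm (v n) < 1 / real (Suc n) * (\<phi> (z n) - m) powr \<alpha>"
      by metis
    obtain zb q where zb: "zb \<in> D" "strict_mono q" "(z \<circ> q) \<longlonglongrightarrow> zb"
      using D z(1) unfolding compact_def by metis
    have inv: "(\<lambda>n. 1 / real (Suc (q n))) \<longlonglongrightarrow> 0"
      using LIMSEQ_subseq_LIMSEQ[OF LIMSEQ_inverse_real_of_nat zb(2)]
      by (simp add: o_def inverse_eq_divide)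
    have "(\<lambda>n. \<phi> ((z \<circ> q) n)) \<longlonglongrightarrow> \<phi> zb"
      using \<phi>(2) z(1) zb unfolding continuous_on_sequentially by (auto simp: o_def)
    moreover have "(\<lambda>n. \<phi> ((z \<circ> q) n)) \<longlonglongrightarrow> m"
    proof (rule tendsto_sandwich[where f = "\<lambda>_. m"])
      show "(\<lambda>n. m + 1 / real (Suc (q n))) \<longlonglongrightarrow> m" using tendsto_add[OF tendsto_const inv, of m] by simp
      show "\<forall>\<^sub>F n in sequentially. m \<le> \<phi> ((z \<circ> q) n)"
        using z(2) by (simp add: less_imp_le)
      show "\<forall>\<^sub>F n in sequentially. \<phi> ((z \<circ> q) n) \<le> m + 1 / real (Suc (q n))"
        using z(3) by (simp add: less_imp_le)
    qed simp
    ultimately have \<phi>zb: "\<phi> zb = m" using LIMSEQ_unique by blast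
    \<comment> \<open>Minimality puts \<open>zb\<close> into the domain of the subdifferential,
      where \<open>KL_function\<close> provides the inequality.\<close>
    have "0 \<in> subdifferential F zb"
      using m(1) zb(1) \<phi>zb by (auto simp: subdifferential_def edom_def F)
    then have "KL_at F \<alpha> zb" using KL unfolding KL_function_def by blast
    then obtain r \<kappa> U where r: "r > 0" "\<kappa> > 0" "open U" "zb \<in> U"
      and bd: "\<And>z s v. z \<in> U \<Longrightarrow> F z = ereal s \<Longrightarrow> m < s \<Longrightarrow> s < m + r \<Longrightarrow> v \<in> subdifferential F z
        \<Longrightarrow> \<kappa> * (s - m) powr \<alpha> \<le> norm v"
      using KL_at_subgradient_bound[of F \<alpha> zb m] \<alpha>(2) zb(1) \<phi>zb F by metis
    have "\<forall>\<^sub>F n in sequentially. (z \<circ> q) n \<in> U"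
      using zb(3) r(3,4) topological_tendstoD by blast
    moreover have "\<forall>\<^sub>F n in sequentially. 1 / real (Suc (q n)) < r"
      using order_tendstoD(2)[OF inv] r(1) by blast
    moreover have "\<forall>\<^sub>F n in sequentially. 1 / real (Suc (q n)) < \<kappa>"
      using order_tendstoD(2)[OF inv] r(2) by blast
    ultimately have "\<forall>\<^sub>F n in sequentially. False"
    proof eventually_elim
      case (elim n)
      have "\<phi> (z (q n)) < m + r" using z(3)[of "q n"] elim(2) by simp
      then have "\<kappa> * (\<phi> (z (q n)) - m) powr \<alpha> \<le> norm (v (q n))"
        using bd[of "z (q n)" "\<phi> (z (q n))" "v (q n)"] elim(1) z v(1) F by simp
      also have "\<dots> < 1 / real (Suc (q n)) * (\<phi> (z (q n)) - m) powr \<alpha>" by (rule v(2))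
      also have "\<dots> \<le> \<kappa> * (\<phi> (z (q n)) - m) powr \<alpha>" using elim(3) by (intro mult_right_mono) auto
      finally show False by simp
    qed
    then show False by simp
  qed
  then obtain r \<kappa> where r: "r > 0" "\<kappa> > 0" and slope: "\<And>z v. z \<in> D \<Longrightarrow> m < \<phi> z \<Longrightarrow> \<phi> z < m + r \<Longrightarrow>
      v \<in> subdifferential F z \<Longrightarrow> \<kappa> * (\<phi> z - m) powr \<alpha> \<le> norm v"
    by blast
  \<comment> \<open>By the chain rule the slope of \<open>(\<phi> w - m) powr (1 - \<alpha>)\<close>
    is at least \<open>\<kappa> * (1 - \<alpha>)\<close> off the minimizers; half of it leaves room
    for a strict contradiction.\<close>
  define \<sigma> where "\<sigma> = \<kappa> * (1 - \<alpha>) / 2"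
  have \<sigma>: "\<sigma> > 0" using r \<alpha> by (simp add: \<sigma>_def)
  have near: "infdist z (Argmin F) \<le> inverse \<sigma> * (\<phi> z - m) powr (1 - \<alpha>)"
    if z: "z \<in> D" "\<phi> z < m + r" for z
  proof -
    define G where "G w = (\<phi> w - m) powr (1 - \<alpha>) + \<sigma> * norm (w - z)" for w
    have "continuous_on D G"
      unfolding G_def using m(1) \<alpha> by (intro continuous_intros continuous_on_powr' \<phi>(2)) auto
    then obtain w where w: "w \<in> D" "\<And>w'. w' \<in> D \<Longrightarrow> G w \<le> G w'"
      using continuous_attains_inf[OF D] z(1) by blast
    have Gz: "G w \<le> (\<phi> z - m) powr (1 - \<alpha>)" using w(2)[OF z(1)] \<alpha> by (simp add: G_def)
    have "\<phi> w = m"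
    proof (rule ccontr)
      define s where "s = \<phi> w - m"
      assume "\<phi> w \<noteq> m"
      then have s: "s > 0" using m(1)[OF w(1)] by (simp add: s_def)
      \<comment> \<open>Comparing \<open>G w\<close> with \<open>G z\<close> shows that
        \<open>w\<close> stays in the sublevel set on which \<open>slope\<close> applies.\<close>
      have "s powr (1 - \<alpha>) \<le> G w" using \<sigma> by (simp add: G_def s_def)
      then have "s powr (1 - \<alpha>) \<le> (\<phi> z - m) powr (1 - \<alpha>)" using Gz by simp
      then have "s \<le> \<phi> z - m"
        using powr_less_mono2[of "1 - \<alpha>" "\<phi> z - m" s] \<alpha> m(1)[OF z(1)] by fastforce
      then have wr: "\<phi> w < m + r" using z(2) by (simp add: s_def)
      \<comment> \<open>The slope \<open>\<sigma>\<close> of the power of the gap, divided by the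
        derivative \<open>(1 - \<alpha>) * s powr (- \<alpha>)\<close> of the power, as a slope for
        \<open>\<phi>\<close> itself.\<close>
      define \<tau> where "\<tau> = \<sigma> * s powr \<alpha> / (1 - \<alpha>)"
      have "\<phi> w - \<tau> * norm (w' - w) \<le> \<phi> w'" if w': "w' \<in> D" for w'
      proof -
        define s' where "s' = \<phi> w' - m"
        have s': "s' \<ge> 0" using m(1)[OF w'] by (simp add: s'_def)
        have "\<sigma> * norm (w' - z) \<le> \<sigma> * (norm (w' - w) + norm (w - z))"
          using \<sigma> norm_triangle_ineq[of "w' - w" "w - z"] by (intro mult_left_mono) auto
        then have "s powr (1 - \<alpha>) - \<sigma> * norm (w' - w) \<le> s' powr (1 - \<alpha>)"
          using w(2)[OF w'] by (simp add: G_def s_def s'_def algebra_simps)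
        then have "(s powr (1 - \<alpha>) - \<sigma> * norm (w' - w)) * s powr \<alpha> \<le> s' powr (1 - \<alpha>) * s powr \<alpha>"
          by (intro mult_right_mono) auto
        \<comment> \<open>Weighted arithmetic-geometric mean: this is the tangent inequality for the
          concave power at \<open>s\<close>, multiplied by \<open>s powr \<alpha>\<close>.\<close>
        also have "\<dots> \<le> (1 - \<alpha>) * s' + \<alpha> * s"
        proof (cases "s' = 0")
          case False
          then show ?thesis using s s' \<alpha> by (intro Youngs_inequality_0) auto
        qed (use s \<alpha> in simp)
        also have "(s powr (1 - \<alpha>) - \<sigma> * norm (w' - w)) * s powr \<alpha> = s - \<sigma> * s powr \<alpha> * norm (w' - w)"
          using s by (simp add: left_diff_distrib powr_add[symmetric])
        finally have "(1 - \<alpha>) * (s - s') \<le> \<sigma> * s powr \<alpha> * norm (w' - w)" by (simp add: algebra_simps)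
        then have "s - s' \<le> \<tau> * norm (w' - w)" using \<alpha> by (simp add: \<tau>_def field_simps)
        then show ?thesis by (simp add: s_def s'_def)
      qed
      moreover have "\<tau> \<ge> 0" using \<sigma> \<alpha> by (simp add: \<tau>_def)
      ultimately obtain v where v: "norm v \<le> \<tau>" "\<And>z. z \<in> D \<Longrightarrow> \<phi> w + v \<bullet> (z - w) \<le> \<phi> z"
        using convex_on_subgradient_le[OF \<phi>(1) w(1)] by metis
      have "v \<in> subdifferential F w" using v(2) w(1) by (simp add: subdifferential_def edom_def F)
      then have "\<kappa> * s powr \<alpha> \<le> norm v" using slope[OF w(1) _ wr] s by (simp add: s_def)
      also have "\<dots> \<le> \<tau>" by (rule v(1))
      also have "\<tau> = \<kappa> * s powr \<alpha> / 2" using \<alpha> by (auto simp: \<tau>_def \<sigma>_def field_simps)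
      finally show False using r(2) s by simp
    qed
    then have "infdist z (Argmin F) \<le> dist z w" using w(1) Argmin by (intro infdist_le) auto
    also have "dist z w \<le> inverse \<sigma> * (\<phi> z - m) powr (1 - \<alpha>)"
      using Gz \<open>\<phi> w = m\<close> \<alpha> \<sigma> by (simp add: G_def dist_norm norm_minus_commute field_simps)
    finally show ?thesis .
  qed
  \<comment> \<open>The second summand serves the points with gap at least \<open>r\<close>, where
    \<open>r powr (1 - \<alpha>)\<close> is at most the power of the gap.\<close>
  define K where "K = inverse \<sigma> + diameter D / r powr (1 - \<alpha>)"
  have diam: "diameter D \<ge> 0" using diameter_ge_0 D compact_imp_bounded by blast
  have K: "inverse \<sigma> \<le> K" "diameter D / r powr (1 - \<alpha>) \<le> K"
    using \<sigma> r(1) diam by (auto simp: K_def)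
  have K0: "K \<ge> 0" using K(1) \<sigma> by (meson inverse_nonnegative_iff_nonnegative less_imp_le order_trans)
  have "infdist z (Argmin F) \<le> K * (\<phi> z - m) powr (1 - \<alpha>)" if z: "z \<in> D" for z
  proof (cases "\<phi> z < m + r")
    case True
    note near[OF z True]
    also have "inverse \<sigma> * (\<phi> z - m) powr (1 - \<alpha>) \<le> K * (\<phi> z - m) powr (1 - \<alpha>)"
      using K(1) by (intro mult_right_mono) auto
    finally show ?thesis .
  next
    case False
    have "infdist z (Argmin F) \<le> dist z zs" using m Argmin by (intro infdist_le) auto
    also have "\<dots> \<le> diameter D" using diameter_bounded_bound D compact_imp_bounded z m(2) by blast
    also have "\<dots> = diameter D / r powr (1 - \<alpha>) * r powr (1 - \<alpha>)" using r(1) by simp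
    also have "\<dots> \<le> K * (\<phi> z - m) powr (1 - \<alpha>)"
      using K K0 r(1) \<alpha> False by (intro mult_mono powr_mono2) auto
    finally show ?thesis .
  qed
  then show ?thesis using that K0 by blast
qed

subsection \<open>Rate of the penalized objective\<close>

text \<open>Minimality is tested at the midpoint of \<open>x'\<close> and \<open>w\<close>. The
  parallelogram identity leaves a multiple of \<open>(norm (w - x'))\<^sup>2\<close>, and the factor
  \<open>a / 4\<close> is what the midpoint yields.\<close>

lemma prox_step_ineq:
  fixes h :: "'a::euclidean_space \<Rightarrow> real"
  assumes h: "convex_on S h" and S: "x' \<in> S" "w \<in> S"
    and min: "\<And>z. z \<in> S \<Longrightarrow> d \<bullet> (x' - x) + a / 2 * (norm (x' - x))\<^sup>2 + h x'
                \<le> d \<bullet> (z - x) + a / 2 * (norm (z - x))\<^sup>2 + h z"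
  shows "d \<bullet> (x' - x) + a / 2 * (norm (x' - x))\<^sup>2 + h x' + a / 4 * (norm (w - x'))\<^sup>2
                \<le> d \<bullet> (w - x) + a / 2 * (norm (w - x))\<^sup>2 + h w"
proof -
  define z where "z = (1 - 1 / 2) *\<^sub>R x' + (1 / 2 :: real) *\<^sub>R w"
  have z: "z \<in> S" unfolding z_def using convex_on_imp_convex[OF h] S by (intro convexD) auto
  have hz: "h z \<le> h x' / 2 + h w / 2"
    unfolding z_def using convex_onD[OF h, of "1 / 2" x' w] S by simp
  have zx: "z - x = (1 / 2 :: real) *\<^sub>R ((x' - x) + (w - x))"
    by (simp add: z_def algebra_simps flip: scaleR_add_left)
  have lin: "d \<bullet> (z - x) = (d \<bullet> (x' - x) + d \<bullet> (w - x)) / 2"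
    unfolding zx by (simp add: inner_add_right)
  have wx: "w - x' = (w - x) - (x' - x)" by simp
  have quad: "(norm (z - x))\<^sup>2 = (norm (x' - x))\<^sup>2 / 2 + (norm (w - x))\<^sup>2 / 2 - (norm (w - x'))\<^sup>2 / 4"
    unfolding zx wx power2_norm_eq_inner
    by (simp only: inner_simps inner_commute[of "w - x" "x' - x"]) (simp add: field_simps)
  have "a / 2 * (norm (z - x))\<^sup>2
      = a / 2 * (norm (x' - x))\<^sup>2 / 2 + a / 2 * (norm (w - x))\<^sup>2 / 2 - a / 4 * (norm (w - x'))\<^sup>2 / 2"
    unfolding quad by (simp add: algebra_simps)
  moreover define P Q V W where "P = a / 2 * (norm (x' - x))\<^sup>2" and "Q = a / 2 * (norm (w - x))\<^sup>2"
    and "V = a / 4 * (norm (w - x'))\<^sup>2" and "W = a / 2 * (norm (z - x))\<^sup>2"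
  ultimately have "W = P / 2 + Q / 2 - V / 2" by simp
  then show ?thesis
    using min[OF z] hz lin unfolding P_def[symmetric] Q_def[symmetric] V_def[symmetric] W_def[symmetric]
    by argo
qed

text \<open>The \<open>x\<close>-step is evaluated at \<open>x + a (xs - x)\<close>; the strong convexity term at that point
  absorbs the part of the cross term \<open>A (x' - x) \<bullet> B (ys - y)\<close> that is only of first order in \<open>a\<close>.\<close>

lemma penalty_splitting_step:
  fixes A :: "'a::euclidean_space \<Rightarrow> 'c::euclidean_space" and B :: "'b::euclidean_space \<Rightarrow> 'c"
  assumes A: "linear A" and B: "linear B" and h: "convex_on S h" and k: "convex_on T k"
    and S: "x \<in> S" "x' \<in> S" "xs \<in> S" and T: "y \<in> T" "u \<in> T" "ys \<in> T"
    and feas: "A xs + B ys = c"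
    and f1: "f1 x + df \<bullet> (xs - x) \<le> f1 xs" "f1 x' \<le> f1 x + df \<bullet> (x' - x) + e1"
    and g1: "g1 y + dg \<bullet> (ys - y) \<le> g1 ys" "g1 y' \<le> g1 y + dg \<bullet> (y' - y) + e2"
    and a: "0 \<le> a" "a \<le> 1" and \<beta>: "0 \<le> \<beta>" and H: "0 \<le> H"
    and l: "\<And>v. (norm (A v))\<^sup>2 \<le> l * (norm v)\<^sup>2"
    and xmin: "\<And>z. z \<in> S \<Longrightarrow>
        (df + \<beta> *\<^sub>R adjoint A (A x + B y - c)) \<bullet> (x' - x) + (H + l * \<beta>) / 2 * (norm (x' - x))\<^sup>2 + h x'
      \<le> (df + \<beta> *\<^sub>R adjoint A (A x + B y - c)) \<bullet> (z - x) + (H + l * \<beta>) / 2 * (norm (z - x))\<^sup>2 + h z"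
    and umin: "(dg + \<beta> *\<^sub>R adjoint B (A x' + B y - c)) \<bullet> u + k u
      \<le> (dg + \<beta> *\<^sub>R adjoint B (A x' + B y - c)) \<bullet> ys + k ys"
    and y': "y' = y + a *\<^sub>R (u - y)"
  shows "f1 x' + h x' + (g1 y' + k y') + \<beta> / 2 * (norm (A x' + B y' - c))\<^sup>2
    \<le> (1 - a) * (f1 x + h x + (g1 y + k y)) + a * (f1 xs + h xs + (g1 ys + k ys))
      + (1 - 2 * a) * (\<beta> / 2 * (norm (A x + B y - c))\<^sup>2)
      + (e1 - H / 2 * (norm (x' - x))\<^sup>2) + e2 + a\<^sup>2 * ((H + l * \<beta>) / 2 * (norm (xs - x))\<^sup>2)
      + a\<^sup>2 * (\<beta> * ((norm (B (u - y)))\<^sup>2 / 2 + (norm (B (ys - y)))\<^sup>2 + A (xs - x) \<bullet> B (ys - y)))"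
proof -
  define r p d q w where "r = A x + B y - c" and "p = A (x' - x)" and "d = A (xs - x)"
    and "q = B (ys - y)" and "w = B (u - y)"
  have R': "A x' + B y - c = r + p"
    by (simp add: r_def p_def linear_diff[OF A])
  have R'': "A x' + B y' - c = r + p + a *\<^sub>R w"
    by (simp add: r_def p_def w_def y' linear_diff[OF A] linear_add[OF B] linear_scale[OF B])
  \<comment> \<open>Feasibility of \<open>(xs, ys)\<close> means \<open>d + q = - r\<close>. This is
    the source of the contraction factor \<open>1 - 2 * a\<close> of the penalty.\<close>
  have dq: "r \<bullet> d + r \<bullet> q = - (norm r)\<^sup>2"
  proof -
    have "d + q = - r"
      using feas by (simp add: d_def q_def r_def linear_diff[OF A] linear_diff[OF B] algebra_simps)
    then have "r \<bullet> (d + q) = r \<bullet> (- r)" by simp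
    then show ?thesis by (simp add: inner_add_right power2_norm_eq_inner)
  qed
  define xt where "xt = (1 - a) *\<^sub>R x + a *\<^sub>R xs"
  have xt: "xt \<in> S" unfolding xt_def using convex_on_imp_convex[OF h] S a by (intro convexD) auto
  have hxt: "h xt \<le> (1 - a) * h x + a * h xs"
    unfolding xt_def using S a by (intro convex_onD[OF h]) auto
  have xtx: "xt - x = a *\<^sub>R (xs - x)" by (simp add: xt_def algebra_simps)
  have "(df + \<beta> *\<^sub>R adjoint A r) \<bullet> (x' - x) + (H + l * \<beta>) / 2 * (norm (x' - x))\<^sup>2 + h x'
      + (H + l * \<beta>) / 4 * (norm (xt - x'))\<^sup>2
      \<le> (df + \<beta> *\<^sub>R adjoint A r) \<bullet> (xt - x) + (H + l * \<beta>) / 2 * (norm (xt - x))\<^sup>2 + h xt"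
    unfolding r_def by (rule prox_step_ineq[OF h S(2) xt xmin])
  also have "(df + \<beta> *\<^sub>R adjoint A r) \<bullet> (x' - x) = df \<bullet> (x' - x) + \<beta> * (r \<bullet> p)"
    by (simp add: inner_add_left p_def adjoint_clauses[OF A])
  also have "(df + \<beta> *\<^sub>R adjoint A r) \<bullet> (xt - x) = a * (df \<bullet> (xs - x)) + a * (\<beta> * (r \<bullet> d))"
    unfolding xtx by (simp add: inner_add_left d_def adjoint_clauses[OF A] distrib_left)
  also have "(norm (xt - x))\<^sup>2 = a\<^sup>2 * (norm (xs - x))\<^sup>2"
    unfolding xtx by (simp add: power_mult_distrib)
  finally have X: "df \<bullet> (x' - x) + \<beta> * (r \<bullet> p) + (H + l * \<beta>) / 2 * (norm (x' - x))\<^sup>2 + h x'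
      + (H + l * \<beta>) / 4 * (norm (xt - x'))\<^sup>2
      \<le> a * (df \<bullet> (xs - x)) + a * (\<beta> * (r \<bullet> d)) + a\<^sup>2 * ((H + l * \<beta>) / 2 * (norm (xs - x))\<^sup>2)
        + ((1 - a) * h x + a * h xs)"
    using hxt by (simp add: algebra_simps)
  \<comment> \<open>The part \<open>l * \<beta>\<close> of the proximal weight dominates the
    quadratic term that the change of \<open>x\<close> causes in the penalty.\<close>
  have pn: "\<beta> / 2 * (norm p)\<^sup>2 \<le> l * \<beta> / 2 * (norm (x' - x))\<^sup>2"
    using mult_left_mono[OF l[of "x' - x"], of "\<beta> / 2"] \<beta> by (simp add: p_def mult.assoc mult.left_commute)
  have "A (xt - x') = a *\<^sub>R d - p"
  proof -
    have *: "xt - x' = a *\<^sub>R (xs - x) - (x' - x)" unfolding xtx[symmetric] by simp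
    show ?thesis
      unfolding * d_def p_def by (simp add: linear_diff[OF A] linear_scale[OF A] del: add_diff_cancel)
  qed
  then have "norm (A (xt - x')) = norm (p - a *\<^sub>R d)" by (simp only: norm_minus_commute)
  then have "\<beta> / 4 * (norm (p - a *\<^sub>R d))\<^sup>2 \<le> \<beta> / 4 * (l * (norm (xt - x'))\<^sup>2)"
    using l[of "xt - x'"] \<beta> by (intro mult_left_mono) auto
  moreover have "0 \<le> H / 4 * (norm (xt - x'))\<^sup>2" using H by simp
  \<comment> \<open>The strong convexity surplus at \<open>xt\<close> is kept in this form to pay
    for the square that appears in \<open>cross\<close>.\<close>
  ultimately have en: "\<beta> / 4 * (norm (p - a *\<^sub>R d))\<^sup>2 \<le> (H + l * \<beta>) / 4 * (norm (xt - x'))\<^sup>2"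
    by (simp add: algebra_simps add_divide_distrib)
  have R'n: "(norm (r + p))\<^sup>2 = (norm r)\<^sup>2 + 2 * (r \<bullet> p) + (norm p)\<^sup>2"
    by (simp add: power2_norm_eq_inner inner_simps inner_commute)
  have R''n: "(norm (r + p + a *\<^sub>R w))\<^sup>2 = (norm (r + p))\<^sup>2 + 2 * (a * ((r + p) \<bullet> w)) + a\<^sup>2 * (norm w)\<^sup>2"
    unfolding power2_norm_eq_inner by (simp add: inner_simps inner_commute power2_eq_square algebra_simps)
  have "(dg + \<beta> *\<^sub>R adjoint B (r + p)) \<bullet> (u - y) + k u \<le> (dg + \<beta> *\<^sub>R adjoint B (r + p)) \<bullet> (ys - y) + k ys"
    using umin unfolding R' by (simp add: inner_diff_right)
  then have "dg \<bullet> (u - y) + \<beta> * ((r + p) \<bullet> w) + k u \<le> dg \<bullet> (ys - y) + \<beta> * ((r + p) \<bullet> q) + k ys"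
    by (simp add: inner_add_left w_def q_def adjoint_clauses[OF B])
  then have "a * (dg \<bullet> (u - y) + \<beta> * ((r + p) \<bullet> w) + k u) \<le> a * (dg \<bullet> (ys - y) + \<beta> * ((r + p) \<bullet> q) + k ys)"
    using a(1) by (rule mult_left_mono)
  then have U: "a * (dg \<bullet> (u - y)) + \<beta> * (a * ((r + p) \<bullet> w)) + a * k u
      \<le> a * (dg \<bullet> (ys - y)) + \<beta> * (a * ((r + p) \<bullet> q)) + a * k ys"
    by (simp add: algebra_simps)
  have "y' = (1 - a) *\<^sub>R y + a *\<^sub>R u" by (simp add: y' algebra_simps)
  then have ky: "k y' \<le> (1 - a) * k y + a * k u"
    using convex_onD[OF k a] T by simp
  have gy: "g1 y' \<le> g1 y + a * (dg \<bullet> (u - y)) + e2" using g1(2) by (simp add: y')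
  \<comment> \<open>Writing \<open>p\<close> as \<open>a *\<^sub>R d\<close> plus a remainder
    \<open>e\<close>, only \<open>a * (e \<bullet> q)\<close> is of first order in \<open>a\<close>;
    completing the square trades it for \<open>(norm e)\<^sup>2 / 4\<close> and a term in
    \<open>a\<^sup>2\<close>.\<close>
  have cross: "a * ((r + p) \<bullet> q) \<le> a * (r \<bullet> q) + (norm (p - a *\<^sub>R d))\<^sup>2 / 4 + a\<^sup>2 * ((norm q)\<^sup>2 + d \<bullet> q)"
  proof -
    define e where "e = p - a *\<^sub>R d"
    have "0 \<le> (norm ((1 / 2 :: real) *\<^sub>R e - a *\<^sub>R q))\<^sup>2" by simp
    also have "\<dots> = (norm e)\<^sup>2 / 4 - a * (e \<bullet> q) + a\<^sup>2 * (norm q)\<^sup>2"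
      unfolding power2_norm_eq_inner by (simp add: inner_simps inner_commute power2_eq_square)
    also have "e \<bullet> q = p \<bullet> q - a * (d \<bullet> q)" by (simp add: e_def inner_simps)
    finally show ?thesis by (simp add: e_def inner_add_left power2_eq_square algebra_simps)
  qed
  then have cross': "\<beta> * (a * ((r + p) \<bullet> q))
      \<le> \<beta> * (a * (r \<bullet> q) + (norm (p - a *\<^sub>R d))\<^sup>2 / 4 + a\<^sup>2 * ((norm q)\<^sup>2 + d \<bullet> q))"
    using \<beta> by (rule mult_left_mono)
  have fx: "a * (f1 x + df \<bullet> (xs - x)) \<le> a * f1 xs" and gx: "a * (g1 y + dg \<bullet> (ys - y)) \<le> a * g1 ys"
    using f1(1) g1(1) a(1) by (auto intro: mult_left_mono)
  have rr: "a * (\<beta> * (r \<bullet> d)) + \<beta> * (a * (r \<bullet> q)) = - (2 * a * (\<beta> / 2 * (norm r)\<^sup>2))"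
  proof -
    have "a * (\<beta> * (r \<bullet> d)) + \<beta> * (a * (r \<bullet> q)) = a * \<beta> * (r \<bullet> d + r \<bullet> q)" by (simp add: algebra_simps)
    then show ?thesis unfolding dq by simp
  qed
  have sq: "\<beta> / 2 * (norm (r + p + a *\<^sub>R w))\<^sup>2 = \<beta> / 2 * (norm r)\<^sup>2 + \<beta> * (r \<bullet> p) + \<beta> / 2 * (norm p)\<^sup>2
      + \<beta> * (a * ((r + p) \<bullet> w)) + a\<^sup>2 * (\<beta> * ((norm w)\<^sup>2 / 2))"
    unfolding R''n R'n by (simp add: algebra_simps)
  show ?thesis
    unfolding R'' unfolding r_def[symmetric] d_def[symmetric] q_def[symmetric] w_def[symmetric]
    using X pn en U ky gy cross' fx gx rr sq f1(2)
    by (simp add: algebra_simps add_divide_distrib diff_divide_distrib)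
qed

text \<open>For \<open>d\<close> up to \<open>1 / t\<close> the power of \<open>d\<close> is small
  by itself. For larger \<open>d\<close> it is at most
  \<open>t powr (1 - \<mu>) * d\<^sup>2\<close>, which the quadratic term absorbs; this is why
  \<open>H\<close> grows like \<open>t powr (1 - \<mu>)\<close>.\<close>

lemma holder_error_le:
  fixes \<mu> M H d t :: real
  assumes "0 < \<mu>" "\<mu> \<le> 1" "0 \<le> M" "0 \<le> d" "0 < t" "2 * M / (\<mu> + 1) * t powr (1 - \<mu>) \<le> H"
  shows "M / (\<mu> + 1) * d powr (\<mu> + 1) - H / 2 * d\<^sup>2 \<le> M / (\<mu> + 1) * t powr (- (1 + \<mu>))"
proof (cases "d \<le> 1 / t")
  case True
  have "d powr (\<mu> + 1) \<le> (1 / t) powr (\<mu> + 1)" using True assms by (intro powr_mono2) auto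
  also have "\<dots> = t powr (- (1 + \<mu>))" using assms 
    using powr_minus_divide[of t "\<mu> + 1"] by (simp add: powr_divide add.commute del: minus_add_distrib)
  finally have "M / (\<mu> + 1) * d powr (\<mu> + 1) \<le> M / (\<mu> + 1) * t powr (- (1 + \<mu>))"
    using assms by (intro mult_left_mono) auto
  moreover have "0 \<le> H"
    using assms by (intro order_trans[OF _ assms(6)] mult_nonneg_nonneg) auto
  ultimately show ?thesis by (smt (verit) zero_le_power2 mult_nonneg_nonneg divide_nonneg_pos)
next
  case False
  moreover have "0 < 1 / t" using assms(5) by simp
  ultimately have d: "d > 0" by linarith
  have "d powr (\<mu> + 1) = d powr (\<mu> - 1) * d\<^sup>2"
    using d by (simp add: powr_add powr_diff power2_eq_square)
  also have "d powr (\<mu> - 1) \<le> (1 / t) powr (\<mu> - 1)"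
    using False assms by (intro powr_mono2') auto
  also have "(1 / t) powr (\<mu> - 1) = t powr (1 - \<mu>)"
    using assms powr_minus_divide[of t "\<mu> - 1"] by (simp add: powr_divide)
  finally have "d powr (\<mu> + 1) \<le> t powr (1 - \<mu>) * d\<^sup>2" by (simp add: mult_right_mono)
  then have "M / (\<mu> + 1) * d powr (\<mu> + 1) \<le> M / (\<mu> + 1) * (t powr (1 - \<mu>) * d\<^sup>2)"
    using assms by (intro mult_left_mono) auto
  also have "\<dots> = 2 * M / (\<mu> + 1) * t powr (1 - \<mu>) * (d\<^sup>2 / 2)"
    using assms(1) by (simp add: field_simps)
  also have "\<dots> \<le> H * (d\<^sup>2 / 2)" using assms(6) by (rule mult_right_mono) simp
  finally have "M / (\<mu> + 1) * d powr (\<mu> + 1) - H / 2 * d\<^sup>2 \<le> 0" by simp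
  also have "0 \<le> M / (\<mu> + 1) * t powr (- (1 + \<mu>))" using assms by simp
  finally show ?thesis .
qed

text \<open>Induction after clearing the denominators \<open>(t + 1) * (t + 2)\<close>. The step
  rests on \<open>s powr (1 - \<omega>)\<close> being nondecreasing in \<open>s\<close>, which gives
  \<open>XY\<close>.\<close>

lemma open_loop_recursion_rate:
  fixes E :: "nat \<Rightarrow> real"
  assumes \<omega>: "0 \<le> \<omega>" "\<omega> \<le> 1" and C: "0 \<le> C"
    and E: "\<And>t. t \<ge> 1 \<Longrightarrow> E (Suc t) \<le> real t / (real t + 2) * E t + C * (real t + 1) powr (- (1 + \<omega>))"
  obtains K where "K \<ge> 0" "\<And>t. t \<ge> 1 \<Longrightarrow> E t \<le> K * (real t + 1) powr (- \<omega>)"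
proof -
  \<comment> \<open>The part \<open>2 * \<bar>E 1\<bar>\<close> starts the induction, as
    \<open>2 powr (- \<omega>)\<close> is at least \<open>1 / 2\<close>; the part
    \<open>2 * C\<close> covers the error term, as \<open>t + 2\<close> is at most
    \<open>2 * (t + 1)\<close>.\<close>
  define K where "K = 2 * C + 2 * \<bar>E 1\<bar>"
  have K: "0 \<le> K" "2 * C \<le> K" using C by (auto simp: K_def)
  have "E t \<le> K * (real t + 1) powr (- \<omega>)" if "t \<ge> 1" for t
    using that
  proof (induction t rule: nat_induct_at_least)
    case base
    have "(2::real) powr (- 1) \<le> 2 powr (- \<omega>)" using \<omega> by (intro powr_mono) auto
    then have "1 / 2 \<le> (2::real) powr (- \<omega>)" by (simp add: powr_minus_divide)
    then have "K * (1 / 2) \<le> K * 2 powr (- \<omega>)" using K by (intro mult_left_mono) auto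
    then show ?case using C by (simp add: K_def)
  next
    case (Suc t)
    define X Y where "X = (real t + 1) powr (- \<omega>)" and "Y = (real t + 2) powr (- \<omega>)"
    have XY: "(real t + 1) * X \<le> (real t + 2) * Y"
    proof -
      have "(real t + 1) powr (1 - \<omega>) \<le> (real t + 2) powr (1 - \<omega>)" using \<omega> by (intro powr_mono2) auto
      then show ?thesis by (simp add: X_def Y_def powr_diff powr_minus field_simps)
    qed
    have "E (Suc t) \<le> real t / (real t + 2) * E t + C * (X / (real t + 1))"
      using E[OF Suc.hyps] by (simp add: X_def powr_diff powr_minus divide_simps mult.commute)
    also have "\<dots> \<le> real t / (real t + 2) * (K * X) + C * (X / (real t + 1))"
      using Suc.IH by (intro add_mono mult_left_mono) (auto simp: X_def C)
    finally have "(real t + 1) * ((real t + 2) * E (Suc t))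
        \<le> (real t + 1) * ((real t + 2) * (real t / (real t + 2) * (K * X) + C * (X / (real t + 1))))"
      by (intro mult_left_mono) auto
    also have "\<dots> = (K * real t) * ((real t + 1) * X) + C * ((real t + 2) * X)"
    proof -
      define n where "n = real t"
      have "(n + 2) * (n / (n + 2) * (K * X)) = n * (K * X)" "(n + 1) * (C * (X / (n + 1))) = C * X"
        by (auto simp: n_def)
      moreover have "(n + 1) * ((n + 2) * (P + Q)) = (n + 1) * ((n + 2) * P) + (n + 2) * ((n + 1) * Q)"
        for P Q by (simp add: algebra_simps)
      ultimately show ?thesis unfolding n_def[symmetric] by (simp only:) (simp add: algebra_simps)
    qed
    also have "\<dots> \<le> (K * real t) * ((real t + 2) * Y) + K * ((real t + 2) * Y)"
    proof (rule add_mono)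
      have "C * ((real t + 2) * X) \<le> C * (2 * ((real t + 1) * X))"
        using C by (intro mult_left_mono) (auto simp: X_def)
      also have "\<dots> \<le> C * (2 * ((real t + 2) * Y))" using XY C by (intro mult_left_mono) auto
      also have "\<dots> = (2 * C) * ((real t + 2) * Y)" by simp
      also have "\<dots> \<le> K * ((real t + 2) * Y)" using K by (intro mult_right_mono) (auto simp: Y_def)
      finally show "C * ((real t + 2) * X) \<le> K * ((real t + 2) * Y)" .
    qed (use XY K in \<open>auto intro!: mult_left_mono\<close>)
    also have "\<dots> = (real t + 1) * ((real t + 2) * (K * Y))" by (simp add: algebra_simps)
    finally have "E (Suc t) \<le> K * Y"
      by (simp add: mult_le_cancel_left_pos)
    then show ?case by (simp add: Y_def add.commute)
  qed
  then show ?thesis using that K(1) by blast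
qed

text \<open>If \<open>r\<close> exceeded the bound, both \<open>r\<close> and
  \<open>r - k / b\<close> would exceed \<open>sqrt (e / b)\<close>, so their product would exceed
  \<open>e / b\<close>.\<close>

lemma quadratic_root_le:
  fixes r k e b :: real
  assumes "0 \<le> r" "0 \<le> k" "0 \<le> e" "0 < b" "b * r\<^sup>2 \<le> k * r + e"
  shows "r \<le> k / b + sqrt (e / b)"
proof (rule ccontr)
  assume *: "\<not> ?thesis"
  have s: "0 \<le> sqrt (e / b)" "0 \<le> k / b" using assms by auto
  then have "sqrt (e / b) * sqrt (e / b) < r * (r - k / b)" using * by (intro mult_strict_mono) linarith+
  then have "e / b < r * (r - k / b)" using assms by simp
  then have "e < b * (r * (r - k / b))" using assms(4) by (simp only: pos_divide_less_eq mult.commute)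
  also have "b * (r * (r - k / b)) = b * r\<^sup>2 - k * r"
    using assms(4) by (simp add: field_simps power2_eq_square)
  finally show False using assms(5) by simp
qed

text \<open>\<open>penalty_splitting_step\<close> is applied with the step size
  \<open>2 / (t + 2)\<close>; every error term is \<open>O((t + 1) powr (- (1 + \<omega>)))\<close>,
  so the open-loop recursion applies to the penalized gap \<open>E\<close>.\<close>

lemma penalty_splitting_rate:
  fixes A :: "'a::euclidean_space \<Rightarrow> 'c::euclidean_space" and B :: "'b::euclidean_space \<Rightarrow> 'c"
    and x :: "nat \<Rightarrow> 'a" and y u :: "nat \<Rightarrow> 'b"
  assumes A: "linear A" and B: "linear B" and h: "convex_on S h" and k: "convex_on T k"
    and bdd: "bounded S" "bounded T"
    and f1: "\<And>v w. f1 v + df v \<bullet> (w - v) \<le> f1 w"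
      "\<And>v w. v \<in> S \<Longrightarrow> w \<in> S \<Longrightarrow>
         f1 w \<le> f1 v + df v \<bullet> (w - v) + Mf / (\<mu> + 1) * norm (w - v) powr (\<mu> + 1)"
    and g1: "\<And>v w. g1 v + dg v \<bullet> (w - v) \<le> g1 w"
      "\<And>v w. v \<in> T \<Longrightarrow> w \<in> T \<Longrightarrow>
         g1 w \<le> g1 v + dg v \<bullet> (w - v) + Mg / (\<nu> + 1) * norm (w - v) powr (\<nu> + 1)"
    and par: "0 < \<mu>" "\<mu> \<le> 1" "0 < \<nu>" "\<nu> \<le> 1" "0 \<le> Mf" "0 \<le> Mg" "0 < \<beta>0" "0 < H0" "0 < \<delta>" "\<delta> < 1"
    and l: "\<And>v. (norm (A v))\<^sup>2 \<le> l * (norm v)\<^sup>2"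
    and xys: "xs \<in> S" "ys \<in> T" "A xs + B ys = c"
    and mem: "\<And>t. x t \<in> S" "\<And>t. y t \<in> T" "\<And>t. u t \<in> T"
    and \<beta>: "\<And>t. \<beta> t = \<beta>0 * (real t + 1) powr \<delta>"
    and H: "\<And>t. H (Suc t) = max H0 (2 * Mf / (\<mu> + 1)) * (real t + 1) powr (1 - \<mu>)"
    and xmin: "\<And>t z. z \<in> S \<Longrightarrow>
        (df (x t) + \<beta> t *\<^sub>R adjoint A (A (x t) + B (y t) - c)) \<bullet> (x (Suc t) - x t)
          + (H t + l * \<beta> t) / 2 * (norm (x (Suc t) - x t))\<^sup>2 + h (x (Suc t))
        \<le> (df (x t) + \<beta> t *\<^sub>R adjoint A (A (x t) + B (y t) - c)) \<bullet> (z - x t)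
          + (H t + l * \<beta> t) / 2 * (norm (z - x t))\<^sup>2 + h z"
    and umin: "\<And>t z. z \<in> T \<Longrightarrow>
        (dg (y t) + \<beta> t *\<^sub>R adjoint B (A (x (Suc t)) + B (y t) - c)) \<bullet> u t + k (u t)
        \<le> (dg (y t) + \<beta> t *\<^sub>R adjoint B (A (x (Suc t)) + B (y t) - c)) \<bullet> z + k z"
    and ystep: "\<And>t. y (Suc t) = y t + (2 / (real t + 2)) *\<^sub>R (u t - y t)"
    and \<omega>: "0 \<le> \<omega>" "\<omega> \<le> 1 - \<delta>" "\<omega> \<le> \<nu>" "\<omega> \<le> \<mu>"
  obtains K where "0 \<le> K" "\<And>t. t \<ge> 1 \<Longrightarrow>
      f1 (x t) + h (x t) + (g1 (y t) + k (y t))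
        + \<beta>0 * real t powr \<delta> / 2 * (norm (A (x t) + B (y t) - c))\<^sup>2
      \<le> f1 xs + h xs + (g1 ys + k ys) + K * (real t + 1) powr (- \<omega>)"
proof -
  define opt where "opt = f1 xs + h xs + (g1 ys + k ys)"
  define \<Phi> where "\<Phi> t = f1 (x t) + h (x t) + (g1 (y t) + k (y t))" for t
  define N where "N t = (norm (A (x t) + B (y t) - c))\<^sup>2" for t
  \<comment> \<open>For \<open>t \<ge> 1\<close> the weight
    \<open>\<beta>0 * real t powr \<delta>\<close> is \<open>\<beta> (t - 1)\<close>, the one in
    force when iterate \<open>t\<close> was computed.\<close>
  define E where "E t = \<Phi> t - opt + \<beta>0 * real t powr \<delta> / 2 * N t" for t
  obtain M where M0: "M \<ge> 0" and M: "\<And>v w. v \<in> S \<Longrightarrow> w \<in> S \<Longrightarrow> norm (v - w) \<le> M"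
    "\<And>v w. v \<in> T \<Longrightarrow> w \<in> T \<Longrightarrow> norm (v - w) \<le> M"
  proof
    show "0 \<le> diameter S + diameter T" using bdd by (intro add_nonneg_nonneg diameter_ge_0)
    show "norm (v - w) \<le> diameter S + diameter T" if "v \<in> S" "w \<in> S" for v w
      using diameter_bounded_bound[OF bdd(1) that] diameter_ge_0[OF bdd(2)] by (simp add: dist_norm)
    show "norm (v - w) \<le> diameter S + diameter T" if "v \<in> T" "w \<in> T" for v w
      using diameter_bounded_bound[OF bdd(2) that] diameter_ge_0[OF bdd(1)] by (simp add: dist_norm)
  qed
  obtain ka where ka: "ka > 0" "\<And>v. norm (A v) \<le> ka * norm v" using linear_bounded_pos[OF A] by blast
  obtain kb where kb: "kb > 0" "\<And>v. norm (B v) \<le> kb * norm v" using linear_bounded_pos[OF B] by blast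
  define Q where "Q = (kb * M)\<^sup>2 / 2 + (kb * M)\<^sup>2 + (ka * M) * (kb * M)"
  have Q0: "Q \<ge> 0" using ka kb M0 by (simp add: Q_def)
  have AM: "norm (A (v - w)) \<le> ka * M" if "v \<in> S" "w \<in> S" for v w
    using ka(1) by (intro order_trans[OF ka(2)] mult_left_mono M(1) that) simp
  have BM: "norm (B (v - w)) \<le> kb * M" if "v \<in> T" "w \<in> T" for v w
    using kb(1) by (intro order_trans[OF kb(2)] mult_left_mono M(2) that) simp
  have l0: "l \<ge> 0"
  proof -
    obtain b :: 'a where "b \<in> Basis" using nonempty_Basis by blast
    then have "(norm b)\<^sup>2 = 1" by simp
    then show ?thesis using l[of b] by (metis mult.right_neutral order_trans zero_le_power2)
  qed
  define H1 where "H1 = max H0 (2 * Mf / (\<mu> + 1))"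
  have H1: "H1 > 0" "2 * Mf / (\<mu> + 1) \<le> H1" using par by (auto simp: H1_def)
  \<comment> \<open>One summand for each of \<open>err1\<close> to \<open>err4\<close>. The
    condition \<open>\<omega> \<le> \<mu>\<close> serves \<open>err1\<close> and the
    \<open>H\<close> part of \<open>err3\<close>, \<open>\<omega> \<le> \<nu>\<close> serves
    \<open>err2\<close>, and \<open>\<omega> \<le> 1 - \<delta>\<close> serves the terms with
    \<open>\<beta>\<close>.\<close>
  define C where "C = Mf * 4 + Mg * (2 * M) powr (\<nu> + 1) + (2 * H1 + 2 * l * \<beta>0) * M\<^sup>2 + 4 * \<beta>0 * Q"
  have C0: "C \<ge> 0" unfolding C_def using par H1 l0 Q0 by (intro add_nonneg_nonneg mult_nonneg_nonneg) auto
  have decrease: "E (Suc t) \<le> real t / (real t + 2) * E t + C * (real t + 1) powr (- (1 + \<omega>))" if t: "t \<ge> 1" for t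
  proof -
    define a where "a = 2 / (real t + 2)"
    define P where "P = (real t + 1) powr (- (1 + \<omega>))"
    have P0: "P \<ge> 0" by (simp add: P_def)
    have t0: "real t \<ge> 1" using t by simp
    have a: "0 \<le> a" "a \<le> 1" by (auto simp: a_def)
    \<comment> \<open>The update rule for \<open>H\<close> describes only positive indices, which is
      one reason for starting the recursion at \<open>t = 1\<close>.\<close>
    have Ht: "H t = H1 * real t powr (1 - \<mu>)"
    proof -
      obtain n where "t = Suc n" using t by (cases t) auto
      then show ?thesis using H[of n] by (simp add: H1_def add.commute)
    qed
    have Ht0: "H t \<ge> 0" using H1 by (simp add: Ht)
    have \<beta>t0: "\<beta> t \<ge> 0" using par by (simp add: \<beta>)
    have P_ge: "(real t + 1) powr (- (1 + s)) \<le> P" if "\<omega> \<le> s" for s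
      unfolding P_def using that by (intro powr_mono) auto
    have err1: "Mf / (\<mu> + 1) * norm (x (Suc t) - x t) powr (\<mu> + 1) - H t / 2 * (norm (x (Suc t) - x t))\<^sup>2
        \<le> Mf * 4 * P"
    proof -
      have "2 * Mf / (\<mu> + 1) * real t powr (1 - \<mu>) \<le> H t"
        unfolding Ht using H1 by (intro mult_right_mono) auto
      then have "Mf / (\<mu> + 1) * norm (x (Suc t) - x t) powr (\<mu> + 1) - H t / 2 * (norm (x (Suc t) - x t))\<^sup>2
        \<le> Mf / (\<mu> + 1) * real t powr (- (1 + \<mu>))"
        using par t0 by (intro holder_error_le) auto
      also have "\<dots> \<le> Mf * (4 * P)"
      proof (rule mult_mono)
        \<comment> \<open>\<open>t\<close> is at least \<open>(t + 1) / 2\<close>, and the resulting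
          factor \<open>2 powr (1 + \<mu>)\<close> is at most 4.\<close>
        have "real t powr (- (1 + \<mu>)) \<le> ((real t + 1) / 2) powr (- (1 + \<mu>))"
          using t0 par by (intro powr_mono2') auto
        also have "\<dots> = 2 powr (1 + \<mu>) * (real t + 1) powr (- (1 + \<mu>))"
          using powr_minus_divide[of 2 "1 + \<mu>"] by (simp add: powr_divide)
        also have "\<dots> \<le> 2 powr 2 * P"
          using par \<omega> by (intro mult_mono powr_mono P_ge) auto
        also have "2 powr 2 = (4::real)" by simp
        finally show "real t powr (- (1 + \<mu>)) \<le> 4 * P" .
      qed (use par in \<open>auto simp: divide_le_eq mult_le_cancel_left1\<close>)
      finally show ?thesis by simp
    qed
    have a1: "a \<le> 2 / (real t + 1)" unfolding a_def by (intro divide_left_mono) auto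
    have a2: "a\<^sup>2 \<le> 4 * (real t + 1) powr (- 2)"
    proof -
      have "a\<^sup>2 \<le> (2 / (real t + 1))\<^sup>2" using a1 a by (intro power_mono)
      also have "\<dots> = 4 * (real t + 1) powr (- 2)"
        by (simp add: power_divide powr_minus_divide)
      finally show ?thesis .
    qed
    have aH: "a\<^sup>2 * H t \<le> 4 * H1 * P"
    proof -
      have "H t \<le> H1 * (real t + 1) powr (1 - \<mu>)"
        unfolding Ht using H1 par by (intro mult_left_mono powr_mono2) auto
      then have "a\<^sup>2 * H t \<le> (4 * (real t + 1) powr (- 2)) * (H1 * (real t + 1) powr (1 - \<mu>))"
        using a2 Ht0 by (intro mult_mono) auto
      also have "\<dots> = 4 * H1 * (real t + 1) powr (- 2 + (1 - \<mu>))" by (simp only: powr_add) simp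
      also have "- 2 + (1 - \<mu>) = - (1 + \<mu>)" by simp
      also have "4 * H1 * (real t + 1) powr (- (1 + \<mu>)) \<le> 4 * H1 * P"
        using H1 \<omega> by (intro mult_left_mono P_ge) auto
      finally show ?thesis .
    qed
    have a\<beta>: "a\<^sup>2 * \<beta> t \<le> 4 * \<beta>0 * P"
    proof -
      have "a\<^sup>2 * \<beta> t \<le> (4 * (real t + 1) powr (- 2)) * (\<beta>0 * (real t + 1) powr \<delta>)"
        unfolding \<beta> using a2 par by (intro mult_right_mono) auto
      also have "\<dots> = 4 * \<beta>0 * (real t + 1) powr (- 2 + \<delta>)" by (simp only: powr_add) simp
      also have "- 2 + \<delta> = - (1 + (1 - \<delta>))" by simp
      also have "4 * \<beta>0 * (real t + 1) powr (- (1 + (1 - \<delta>))) \<le> 4 * \<beta>0 * P"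
        using par \<omega> by (intro mult_left_mono P_ge) auto
      finally show ?thesis .
    qed
    have yS: "y (Suc t) = y t + a *\<^sub>R (u t - y t)" by (simp add: ystep a_def)
    have err2: "Mg / (\<nu> + 1) * norm (y (Suc t) - y t) powr (\<nu> + 1) \<le> Mg * (2 * M) powr (\<nu> + 1) * P"
    proof -
      have "norm (y (Suc t) - y t) = a * norm (u t - y t)" using a by (simp add: yS)
      also have "\<dots> \<le> 2 / (real t + 1) * M" using a a1 M(2)[OF mem(3) mem(2)] M0 by (intro mult_mono) auto
      finally have "norm (y (Suc t) - y t) powr (\<nu> + 1) \<le> (2 * M / (real t + 1)) powr (\<nu> + 1)"
        using par by (intro powr_mono2) auto
      also have "\<dots> = (2 * M) powr (\<nu> + 1) * (real t + 1) powr (- (1 + \<nu>))"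
        using M0 powr_minus_divide[of "real t + 1" "1 + \<nu>"] by (simp add: powr_divide add.commute)
      also have "\<dots> \<le> (2 * M) powr (\<nu> + 1) * P" using \<omega> by (intro mult_left_mono P_ge) auto
      finally have "Mg / (\<nu> + 1) * norm (y (Suc t) - y t) powr (\<nu> + 1) \<le> Mg * ((2 * M) powr (\<nu> + 1) * P)"
        using par by (intro mult_mono) (auto simp: divide_le_eq mult_le_cancel_left1)
      then show ?thesis by simp
    qed
    have err3: "a\<^sup>2 * ((H t + l * \<beta> t) / 2 * (norm (xs - x t))\<^sup>2) \<le> (2 * H1 + 2 * l * \<beta>0) * M\<^sup>2 * P"
    proof -
      have "(norm (xs - x t))\<^sup>2 \<le> M\<^sup>2" using M(1)[OF xys(1) mem(1)] by (intro power_mono) auto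
      moreover have "a\<^sup>2 * H t / 2 + l * (a\<^sup>2 * \<beta> t) / 2 \<le> 4 * H1 * P / 2 + l * (4 * \<beta>0 * P) / 2"
        using aH mult_left_mono[OF a\<beta> l0] by linarith
      ultimately have "(a\<^sup>2 * H t / 2 + l * (a\<^sup>2 * \<beta> t) / 2) * (norm (xs - x t))\<^sup>2
          \<le> (4 * H1 * P / 2 + l * (4 * \<beta>0 * P) / 2) * M\<^sup>2"
        using l0 H1 P0 par by (intro mult_mono) auto
      then show ?thesis by (simp add: algebra_simps add_divide_distrib)
    qed
    have err4: "a\<^sup>2 * (\<beta> t * ((norm (B (u t - y t)))\<^sup>2 / 2 + (norm (B (ys - y t)))\<^sup>2
        + A (xs - x t) \<bullet> B (ys - y t))) \<le> 4 * \<beta>0 * Q * P"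
    proof -
      have "A (xs - x t) \<bullet> B (ys - y t) \<le> norm (A (xs - x t)) * norm (B (ys - y t))"
        by (rule norm_cauchy_schwarz)
      also have "\<dots> \<le> (ka * M) * (kb * M)" using AM BM mem xys ka M0 by (intro mult_mono) auto
      finally have "(norm (B (u t - y t)))\<^sup>2 / 2 + (norm (B (ys - y t)))\<^sup>2 + A (xs - x t) \<bullet> B (ys - y t) \<le> Q"
        unfolding Q_def using BM mem xys by (intro add_mono divide_right_mono power_mono) auto
      then have "(a\<^sup>2 * \<beta> t) * ((norm (B (u t - y t)))\<^sup>2 / 2 + (norm (B (ys - y t)))\<^sup>2
          + A (xs - x t) \<bullet> B (ys - y t)) \<le> (a\<^sup>2 * \<beta> t) * Q"
        using \<beta>t0 by (intro mult_left_mono) auto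
      also have "\<dots> \<le> (4 * \<beta>0 * P) * Q" using a\<beta> Q0 by (rule mult_right_mono)
      finally show ?thesis by (simp add: mult_ac)
    qed
    \<comment> \<open>The step carries the weight \<open>\<beta> t\<close>, while \<open>E t\<close>
      has the smaller weight of the preceding index. The stronger factor \<open>1 - 2 * a\<close> in
      place of \<open>1 - a\<close> pays for this growth.\<close>
    have penalty: "(1 - 2 * a) * (\<beta> t / 2 * N t) \<le> (1 - a) * (\<beta>0 * real t powr \<delta> / 2 * N t)"
    proof (cases "1 - 2 * a \<le> 0")
      case True
      then have "(1 - 2 * a) * (\<beta> t / 2 * N t) \<le> 0"
        using \<beta>t0 by (intro mult_nonpos_nonneg) (auto simp: N_def)
      also have "0 \<le> (1 - a) * (\<beta>0 * real t powr \<delta> / 2 * N t)"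
        using a par by (intro mult_nonneg_nonneg) (auto simp: N_def)
      finally show ?thesis .
    next
      case False
      \<comment> \<open>As \<open>\<delta> < 1\<close>, the weights have ratio at most
        \<open>(t + 1) / t\<close>, so the claim reduces to
        \<open>(t - 2) * (t + 1) \<le> t * t\<close>.\<close>
      have "((real t + 1) / real t) powr \<delta> \<le> ((real t + 1) / real t) powr 1"
        using t0 par by (intro powr_mono) auto
      then have "(real t + 1) powr \<delta> \<le> (real t + 1) / real t * real t powr \<delta>"
        using t0 by (simp add: powr_divide field_simps)
      then have "(1 - 2 * a) * (real t + 1) powr \<delta> \<le> (1 - 2 * a) * ((real t + 1) / real t * real t powr \<delta>)"
        using False by (intro mult_left_mono) auto
      also have "\<dots> = ((1 - 2 * a) * ((real t + 1) / real t)) * real t powr \<delta>" by simp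
      also have "\<dots> \<le> (1 - a) * real t powr \<delta>"
      proof (rule mult_right_mono)
        have "(real t - 2) * (real t + 1) \<le> real t * real t" using t0 by (simp add: algebra_simps)
        then have "(real t - 2) * (real t + 1) / ((real t + 2) * real t) \<le> real t * real t / ((real t + 2) * real t)"
          by (intro divide_right_mono) auto
        moreover have "1 - 2 * a = (real t - 2) / (real t + 2)" "1 - a = real t / (real t + 2)"
          by (auto simp: a_def field_simps)
        ultimately show "(1 - 2 * a) * ((real t + 1) / real t) \<le> 1 - a" using t0 by simp
      qed simp
      finally have "\<beta>0 * N t / 2 * ((1 - 2 * a) * (real t + 1) powr \<delta>)
          \<le> \<beta>0 * N t / 2 * ((1 - a) * real t powr \<delta>)"
        using par by (intro mult_left_mono) (auto simp: N_def)
      then show ?thesis by (simp add: \<beta> mult_ac)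
    qed
    have step: "\<Phi> (Suc t) + \<beta> t / 2 * N (Suc t)
      \<le> (1 - a) * \<Phi> t + a * opt + (1 - 2 * a) * (\<beta> t / 2 * N t)
        + (Mf / (\<mu> + 1) * norm (x (Suc t) - x t) powr (\<mu> + 1) - H t / 2 * (norm (x (Suc t) - x t))\<^sup>2)
        + Mg / (\<nu> + 1) * norm (y (Suc t) - y t) powr (\<nu> + 1)
        + a\<^sup>2 * ((H t + l * \<beta> t) / 2 * (norm (xs - x t))\<^sup>2)
        + a\<^sup>2 * (\<beta> t * ((norm (B (u t - y t)))\<^sup>2 / 2 + (norm (B (ys - y t)))\<^sup>2
            + A (xs - x t) \<bullet> B (ys - y t)))"
      unfolding \<Phi>_def opt_def N_def
      by (rule penalty_splitting_step[OF A B h k mem(1) mem(1) xys(1) mem(2) mem(3) xys(2) xys(3)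
            f1(1) f1(2)[OF mem(1) mem(1)] g1(1) g1(2)[OF mem(2) mem(2)] a \<beta>t0 Ht0 l xmin umin[OF xys(2)] yS])
    have "\<Phi> (Suc t) + \<beta> t / 2 * N (Suc t)
        \<le> (1 - a) * \<Phi> t + a * opt + (1 - a) * (\<beta>0 * real t powr \<delta> / 2 * N t) + C * P"
    proof -
      have "C * P = Mf * 4 * P + Mg * (2 * M) powr (\<nu> + 1) * P + (2 * H1 + 2 * l * \<beta>0) * M\<^sup>2 * P
          + 4 * \<beta>0 * Q * P"
        unfolding C_def by (simp add: distrib_right)
      then show ?thesis using step penalty err1 err2 err3 err4 by linarith
    qed
    moreover have "E (Suc t) = \<Phi> (Suc t) + \<beta> t / 2 * N (Suc t) - opt"
      by (simp add: E_def \<beta> add.commute)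
    moreover have "(1 - a) * E t = (1 - a) * \<Phi> t + (1 - a) * (\<beta>0 * real t powr \<delta> / 2 * N t) + a * opt - opt"
      by (simp add: E_def algebra_simps)
    ultimately have "E (Suc t) \<le> (1 - a) * E t + C * P" by linarith
    moreover have "1 - a = real t / (real t + 2)" by (simp add: a_def field_simps)
    ultimately show ?thesis by (simp add: P_def)
  qed
  have "\<omega> \<le> 1" using \<omega>(4) par(2) by linarith
  then obtain K where "K \<ge> 0" "\<And>t. t \<ge> 1 \<Longrightarrow> E t \<le> K * (real t + 1) powr (- \<omega>)"
    using open_loop_recursion_rate[OF \<omega>(1) _ C0 decrease] by blast
  then show ?thesis using that[of K] by (simp add: E_def \<Phi>_def N_def opt_def algebra_simps)
qed

subsection \<open>Rate of the distance to the solution set\<close>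

text \<open>Finiteness of \<open>f1\<close> determines \<open>f2\<close> from the two
  decompositions. A difference of convex functions need not be convex, so convexity of
  \<open>f0 - f1\<close> on \<open>S\<close> is read off from the epigraph of
  \<open>f2\<close>.\<close>

lemma composite_nonsmooth_part:
  assumes sum: "\<And>x. f x = ereal (f1 x) + f2 x" and ind: "\<And>x. f x = ereal (f0 x) + ext_indicator S x"
    and f2: "proper_closed_convex f2" and S: "convex S"
  shows "edom f = S" "f2 z = (if z \<in> S then ereal (f0 z - f1 z) else \<infinity>)"
    "convex_on S (\<lambda>z. f0 z - f1 z)"
proof -
  show "edom f = S" by (auto simp: edom_def ind ext_indicator_def)
  have eq: "f2 z = (if z \<in> S then ereal (f0 z - f1 z) else \<infinity>)" for z
  proof -
    have "ereal (f1 z) + f2 z = ereal (f0 z) + ext_indicator S z" using sum ind by metis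
    then show ?thesis by (cases "f2 z") (auto simp: ext_indicator_def split: if_splits)
  qed
  then show "f2 z = (if z \<in> S then ereal (f0 z - f1 z) else \<infinity>)" .
  have epi: "convex (ext_epigraph f2)" using f2 by (simp add: proper_closed_convex_def)
  show "convex_on S (\<lambda>z. f0 z - f1 z)"
  proof (rule convex_onI)
    fix t x y assume t: "0 < t" "t < (1::real)" and xy: "x \<in> S" "y \<in> S"
    define w where "w = (1 - t) *\<^sub>R x + t *\<^sub>R y"
    have w: "w \<in> S" unfolding w_def using S xy t by (intro convexD) auto
    have "(1 - t) *\<^sub>R (x, f0 x - f1 x) + t *\<^sub>R (y, f0 y - f1 y) \<in> ext_epigraph f2"
      using epi t xy by (intro convexD) (auto simp: ext_epigraph_def eq)
    then have "(w, (1 - t) * (f0 x - f1 x) + t * (f0 y - f1 y)) \<in> ext_epigraph f2"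
      by (simp add: w_def)
    then show "f0 ((1 - t) *\<^sub>R x + t *\<^sub>R y) - f1 ((1 - t) *\<^sub>R x + t *\<^sub>R y)
        \<le> (1 - t) * (f0 x - f1 x) + t * (f0 y - f1 y)"
      using w by (simp add: ext_epigraph_def eq flip: w_def)
  qed (rule S)
qed

text \<open>A point of \<open>S\<close> makes the minimal value finite, which forces
  \<open>p\<close> into \<open>S\<close> and turns extended-valued minimality into real
  inequalities.\<close>

lemma Argmin_restricted:
  assumes p: "p \<in> Argmin (\<lambda>z. ereal (q z) + \<psi> z)" and \<psi>: "\<And>z. \<psi> z = (if z \<in> S then ereal (h z) else \<infinity>)"
    and S: "S \<noteq> {}"
  shows "p \<in> S" "z \<in> S \<Longrightarrow> q p + h p \<le> q z + h z"
proof -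
  have le: "ereal (q p) + \<psi> p \<le> ereal (q z) + \<psi> z" for z
    using p by (auto simp: Argmin_def is_arg_min_def not_less)
  obtain s where "s \<in> S" using S by blast
  then show p: "p \<in> S" using le[of s] by (auto simp: \<psi> split: if_splits)
  show "q p + h p \<le> q z + h z" if "z \<in> S" using le[of z] that p by (simp add: \<psi>)
qed

theorem corollary4p5:
  fixes A :: "'a::euclidean_space \<Rightarrow> 'c::euclidean_space"
    and B :: "'b::euclidean_space \<Rightarrow> 'c"
    and c :: 'c
    and f f2 :: "'a \<Rightarrow> ereal" and g g2 :: "'b \<Rightarrow> ereal"
    and f0 f1 :: "'a \<Rightarrow> real" and g0 g1 :: "'b \<Rightarrow> real"
    and grad_f1 :: "'a \<Rightarrow> 'a" and grad_g1 :: "'b \<Rightarrow> 'b"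
    and \<mu> \<nu> Mf Mg \<delta> \<alpha> \<omega>1 \<omega>2 :: real
    and \<Xi> :: "'a set" and \<Delta> :: "'b set"
    and F :: "'a \<times> 'b \<Rightarrow> ereal"
    and x :: "nat \<Rightarrow> 'a" and y u :: "nat \<Rightarrow> 'b"
    and R R' :: "nat \<Rightarrow> 'c"
    and H \<beta> :: "nat \<Rightarrow> real"
  \<comment> \<open>problem (P)\<close>
  assumes "linear A" and "linear B"
    and "proper_closed_convex f" and "proper_closed_convex g"
    and solvable: "\<exists>p. is_arg_min (\<lambda>(x, y). f x + g y) (\<lambda>(x, y). A x + B y = c) p"
  \<comment> \<open>constraint qualification\<close>
    and CQ: "\<exists>x\<in>rel_interior (edom f). \<exists>y\<in>rel_interior (edom g). c = A x + B y"
  \<comment> \<open>Assumption (S)\<close>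
    and "\<And>x. f x = ereal (f1 x) + f2 x" and "\<And>y. g y = ereal (g1 y) + g2 y"
    and "convex_on UNIV f1" and "convex_on UNIV g1"
    and "\<And>x. GDERIV f1 x :> grad_f1 x" and "\<And>y. GDERIV g1 y :> grad_g1 y"
    and "proper_closed_convex f2" and "proper_closed_convex g2"
    and "holder_continuous_on (edom f) grad_f1" and "holder_continuous_on (edom g) grad_g1"
    and "0 < \<mu>" "\<mu> \<le> 1" and "0 < \<nu>" "\<nu> \<le> 1" and "0 \<le> Mf" and "0 \<le> Mg"
    and "\<And>x y. x \<in> edom f \<Longrightarrow> y \<in> edom f \<Longrightarrow>
           f1 y \<le> f1 x + grad_f1 x \<bullet> (y - x) + Mf / (\<mu> + 1) * norm (y - x) powr (\<mu> + 1)"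
    and "\<And>x y. x \<in> edom g \<Longrightarrow> y \<in> edom g \<Longrightarrow>
           g1 y \<le> g1 x + grad_g1 x \<bullet> (y - x) + Mg / (\<nu> + 1) * norm (y - x) powr (\<nu> + 1)"
    and "\<And>v. Argmin (\<lambda>y. ereal (v \<bullet> y) + g2 y) \<noteq> {}"
  \<comment> \<open>compact domains and the KL objective\<close>
    and "\<And>x. f x = ereal (f0 x) + ext_indicator \<Xi> x"
    and "\<And>y. g y = ereal (g0 y) + ext_indicator \<Delta> y"
    and "compact \<Xi>" "convex \<Xi>" and "compact \<Delta>" "convex \<Delta>"
    and "convex_on UNIV f0" and "convex_on UNIV g0"
    and "\<And>x y. F (x, y) = f x + g y + ext_indicator {c} (A x + B y)"
  \<comment> \<open>the algorithm\<close>
    and "x 0 \<in> edom f" and "y 0 \<in> edom g"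
    and "0 < \<beta> 0" and "0 < H 0" and "0 < \<delta>" "\<delta> < 1"
    and "\<And>t. R t = A (x t) + B (y t) - c"
    and "\<And>t. x (Suc t) \<in> Argmin (\<lambda>z.
           ereal ((grad_f1 (x t) + \<beta> t *\<^sub>R adjoint A (R t)) \<bullet> (z - x t)
                  + (H t + lambda_max (adjoint A \<circ> A) * \<beta> t) / 2 * (norm (z - x t))\<^sup>2) + f2 z)"
    and "\<And>t. R' t = A (x (Suc t)) + B (y t) - c"
    and "\<And>t. u t \<in> Argmin (\<lambda>z.
           ereal ((grad_g1 (y t) + \<beta> t *\<^sub>R adjoint B (R' t)) \<bullet> z) + g2 z)"
    and "\<And>t. y (Suc t) = y t + (2 / (real t + 2)) *\<^sub>R (u t - y t)"
    and "\<And>t. H (Suc t) = max (H 0) (2 * Mf / (\<mu> + 1)) * (real t + 1) powr (1 - \<mu>)"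
    and "\<And>t. \<beta> (Suc t) = \<beta> 0 * (real t + 2) powr \<delta>"
  \<comment> \<open>Kurdyka-Lojasiewicz exponent and rates\<close>
    and "0 \<le> \<alpha>" "\<alpha> < 1" and "KL_function F \<alpha>"
    and "\<omega>1 = Min {1 - \<delta>, \<nu>, \<mu>}"
    and "\<omega>2 = Min {\<delta>, 1 / 2, (\<nu> + \<delta>) / 2, (\<mu> + \<delta>) / 2}"
  shows "(\<lambda>t. infdist (x t, y t) (Argmin F)) \<in> O(\<lambda>t. (real t + 1) powr (- (1 - \<alpha>) * min \<omega>1 \<omega>2))"
proof -

  \<comment> \<open>Reduction to a real convex function on a compact convex set\<close>
  note lin = assms(1,2)
  note f_eq = \<open>\<And>x. f x = ereal (f0 x) + ext_indicator \<Xi> x\<close>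
  note g_eq = \<open>\<And>y. g y = ereal (g0 y) + ext_indicator \<Delta> y\<close>
  note cpt = \<open>compact \<Xi>\<close> \<open>convex \<Xi>\<close> \<open>compact \<Delta>\<close> \<open>convex \<Delta>\<close>
  note f = composite_nonsmooth_part[OF \<open>\<And>x. f x = ereal (f1 x) + f2 x\<close> f_eq
      \<open>proper_closed_convex f2\<close> \<open>convex \<Xi>\<close>]
  note g = composite_nonsmooth_part[OF \<open>\<And>y. g y = ereal (g1 y) + g2 y\<close> g_eq
      \<open>proper_closed_convex g2\<close> \<open>convex \<Delta>\<close>]
  define L where "L z = A (fst z) + B (snd z)" for z
  have L: "linear L"
    unfolding L_def by (intro linearI) (simp_all add: linear_add lin linear_scale algebra_simps)
  define \<phi> where "\<phi> z = f0 (fst z) + g0 (snd z)" for z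
  have \<phi>: "convex_on UNIV \<phi>"
  proof (rule convex_onI)
    fix t :: real and v w :: "'a \<times> 'b" assume t: "0 < t" "t < 1"
    show "\<phi> ((1 - t) *\<^sub>R v + t *\<^sub>R w) \<le> (1 - t) * \<phi> v + t * \<phi> w"
      using convex_onD[OF \<open>convex_on UNIV f0\<close>, of t "fst v" "fst w"]
        convex_onD[OF \<open>convex_on UNIV g0\<close>, of t "snd v" "snd w"] t
      by (simp add: \<phi>_def distrib_left)
  qed simp
  define D where "D = {z \<in> \<Xi> \<times> \<Delta>. L z = c}"
  have F_eq: "F z = (if z \<in> D then ereal (\<phi> z) else \<infinity>)" for z
    by (cases z) (auto simp: \<open>\<And>x y. F (x, y) = f x + g y + ext_indicator {c} (A x + B y)\<close>
        f_eq g_eq ext_indicator_def D_def L_def \<phi>_def)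
  have \<Xi>\<Delta>: "convex (\<Xi> \<times> \<Delta>)" "bounded (\<Xi> \<times> \<Delta>)" "compact (\<Xi> \<times> \<Delta>)"
    using cpt by (auto intro: convex_Times compact_Times compact_imp_bounded bounded_Times)
  have D_Int: "D = (\<Xi> \<times> \<Delta>) \<inter> L -` {c}" by (auto simp: D_def)
  have "convex D" unfolding D_Int
    using \<Xi>\<Delta>(1) L by (intro convex_Int convex_linear_vimage) auto
  moreover have "closed (L -` {c})"
    using L by (intro closed_vimage linear_continuous_on) (auto simp: linear_conv_bounded_linear)
  ultimately have D: "convex D" "compact D" unfolding D_Int using \<Xi>\<Delta>(3) by auto
  have \<phi>D: "convex_on D \<phi>" using \<phi> D(1) convex_on_subset by blast
  have "continuous_on UNIV \<phi>" by (rule convex_on_continuous[OF open_UNIV \<phi>])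
  then have \<phi>_cont: "continuous_on D \<phi>" using continuous_on_subset by blast
  \<comment> \<open>The relative interior of a product is the product of the relative interiors, so
    \<open>CQ\<close> supplies a feasible \<open>z0\<close> of the kind that
    \<open>linear_regularity\<close> requires.\<close>
  obtain z0 where z0: "z0 \<in> rel_interior (\<Xi> \<times> \<Delta>)" "L z0 = c"
    using CQ cpt by (auto simp: f(1) g(1) rel_interior_Times L_def)
  then have z0D: "z0 \<in> D" using rel_interior_subset by (auto simp: D_def)
  obtain xs ys where xys: "A xs + B ys = c"
    and opt: "\<And>v w. A v + B w = c \<Longrightarrow> f xs + g ys \<le> f v + g w"
    using solvable by (auto simp: is_arg_min_def not_less)
  define m where "m = \<phi> (xs, ys)"
  have opt': "f xs + g ys \<le> ereal (\<phi> z)" if "z \<in> D" for z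
    using opt[of "fst z" "snd z"] that
    by (auto simp: D_def L_def f_eq[of "fst z"] g_eq[of "snd z"] \<phi>_def ext_indicator_def)
  \<comment> \<open>The optimal value is at most the finite number \<open>\<phi> z0\<close>, so
    neither indicator is infinite at the solution.\<close>
  have xysD: "(xs, ys) \<in> D" and xs: "xs \<in> \<Xi>" and ys: "ys \<in> \<Delta>"
    using opt'[OF z0D] xys by (auto simp: f_eq g_eq ext_indicator_def D_def L_def split: if_splits)
  have m_le: "m \<le> \<phi> z" if "z \<in> D" for z
    using opt'[OF that] xs ys by (simp add: f_eq g_eq ext_indicator_def m_def \<phi>_def)

  \<comment> \<open>Regularity, Lipschitz and error bound constants\<close>
  obtain Cr where Cr: "Cr \<ge> 0"
    "\<And>z. z \<in> \<Xi> \<times> \<Delta> \<Longrightarrow> \<exists>z'\<in>\<Xi> \<times> \<Delta>. L z' = c \<and> norm (z - z') \<le> Cr * norm (L z - c)"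
    using linear_regularity[OF L \<Xi>\<Delta>(1,2) z0] by blast
  obtain Cl where Cl: "Cl \<ge> 0"
    "\<And>z z'. z \<in> \<Xi> \<times> \<Delta> \<Longrightarrow> z' \<in> \<Xi> \<times> \<Delta> \<Longrightarrow> \<phi> z' - \<phi> z \<le> Cl * norm (z' - z)"
    using convex_on_lipschitz_on_bounded[OF \<phi> \<Xi>\<Delta>(2)] by blast
  obtain Ce where Ce: "Ce \<ge> 0"
    "\<And>z. z \<in> D \<Longrightarrow> infdist z (Argmin F) \<le> Ce * (\<phi> z - m) powr (1 - \<alpha>)"
    using KL_error_bound[OF F_eq D(2) \<phi>D \<phi>_cont m_le xysD m_def[symmetric] \<open>KL_function F \<alpha>\<close>
        \<open>0 \<le> \<alpha>\<close> \<open>\<alpha> < 1\<close>] by blast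

  have ne: "\<Xi> \<noteq> {}" "\<Delta> \<noteq> {}" using xs ys by auto

  \<comment> \<open>The iterates and the rate of their penalized objective\<close>
  note xArg = Argmin_restricted[OF \<open>\<And>t. x (Suc t) \<in> _\<close> f(2) ne(1)]
  note uArg = Argmin_restricted[OF \<open>\<And>t. u t \<in> _\<close> g(2) ne(2)]
  note R = \<open>\<And>t. R t = A (x t) + B (y t) - c\<close> \<open>\<And>t. R' t = A (x (Suc t)) + B (y t) - c\<close>
  have x_mem: "x t \<in> \<Xi>" for t
    using xArg(1) \<open>x 0 \<in> edom f\<close> by (cases t) (auto simp: f(1))
  have ystep: "y (Suc t) = y t + (2 / (real t + 2)) *\<^sub>R (u t - y t)" for t by fact
  have y_mem: "y t \<in> \<Delta>" for t
  proof (induction t)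
    case 0
    then show ?case using \<open>y 0 \<in> edom g\<close> by (simp add: g(1))
  next
    case (Suc t)
    have "y (Suc t) = (1 - 2 / (real t + 2)) *\<^sub>R y t + (2 / (real t + 2)) *\<^sub>R u t"
      unfolding ystep by (simp add: algebra_simps)
    also have "\<dots> \<in> \<Delta>" using Suc uArg(1) by (intro convexD[OF \<open>convex \<Delta>\<close>]) auto
    finally show ?case .
  qed
  have \<beta>: "\<beta> t = \<beta> 0 * (real t + 1) powr \<delta>" for t
    using \<open>\<And>t. \<beta> (Suc t) = \<beta> 0 * (real t + 2) powr \<delta>\<close> by (cases t) (auto simp: add.commute)
  \<comment> \<open>Averaging \<open>\<delta>\<close> with the entries \<open>1 - \<delta>\<close>,
    \<open>\<nu>\<close>, \<open>\<mu>\<close> of \<open>\<omega>1\<close> gives the last three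
    entries of \<open>\<omega>2\<close>; hence the bound by
    \<open>(\<delta> + \<omega>1) / 2\<close>.\<close>
  have \<omega>1: "0 \<le> \<omega>1" "\<omega>1 \<le> 1 - \<delta>" "\<omega>1 \<le> \<nu>" "\<omega>1 \<le> \<mu>"
    and \<omega>2: "0 \<le> \<omega>2" "\<omega>2 \<le> \<delta>" "\<omega>2 \<le> (\<delta> + \<omega>1) / 2"
    using \<open>0 < \<mu>\<close> \<open>0 < \<nu>\<close> \<open>0 < \<delta>\<close> \<open>\<delta> < 1\<close> unfolding \<open>\<omega>1 = _\<close> \<open>\<omega>2 = _\<close> by (auto simp: min_def)
  have bdd: "bounded \<Xi>" "bounded \<Delta>" using cpt compact_imp_bounded by blast+
  \<comment> \<open>The nonsmooth parts are represented by \<open>f0 - f1\<close> and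
    \<open>g0 - g1\<close>, so the sums collapse to \<open>\<phi>\<close>.\<close>
  obtain K where K: "0 \<le> K" and rate: "\<And>t. t \<ge> 1 \<Longrightarrow>
      f1 (x t) + (f0 (x t) - f1 (x t)) + (g1 (y t) + (g0 (y t) - g1 (y t)))
        + \<beta> 0 * real t powr \<delta> / 2 * (norm (A (x t) + B (y t) - c))\<^sup>2
      \<le> f1 xs + (f0 xs - f1 xs) + (g1 ys + (g0 ys - g1 ys)) + K * (real t + 1) powr (- \<omega>1)"
  proof (rule penalty_splitting_rate[where x = x and y = y and u = u and h = "\<lambda>z. f0 z - f1 z"
        and k = "\<lambda>z. g0 z - g1 z" and ?f1.0 = f1 and ?g1.0 = g1 and df = grad_f1 and dg = grad_g1
        and S = \<Xi> and T = \<Delta> and A = A and B = B and Mf = Mf and Mg = Mg and \<mu> = \<mu> and \<nu> = \<nu>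
        and ?\<beta>0.0 = "\<beta> 0" and ?H0.0 = "H 0" and \<delta> = \<delta> and l = "lambda_max (adjoint A \<circ> A)"
        and xs = xs and ys = ys and c = c and \<beta> = \<beta> and H = H and \<omega> = \<omega>1])
    show "f1 v + grad_f1 v \<bullet> (w - v) \<le> f1 w" for v w
      by (rule convex_on_above_gradient) fact+
    show "g1 v + grad_g1 v \<bullet> (w - v) \<le> g1 w" for v w
      by (rule convex_on_above_gradient) fact+
    show "(grad_f1 (x t) + \<beta> t *\<^sub>R adjoint A (A (x t) + B (y t) - c)) \<bullet> (x (Suc t) - x t)
          + (H t + lambda_max (adjoint A \<circ> A) * \<beta> t) / 2 * (norm (x (Suc t) - x t))\<^sup>2
          + (f0 (x (Suc t)) - f1 (x (Suc t)))
        \<le> (grad_f1 (x t) + \<beta> t *\<^sub>R adjoint A (A (x t) + B (y t) - c)) \<bullet> (z - x t)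
          + (H t + lambda_max (adjoint A \<circ> A) * \<beta> t) / 2 * (norm (z - x t))\<^sup>2 + (f0 z - f1 z)"
      if "z \<in> \<Xi>" for t z
      using xArg(2)[OF that, of t] by (simp add: R)
    show "(grad_g1 (y t) + \<beta> t *\<^sub>R adjoint B (A (x (Suc t)) + B (y t) - c)) \<bullet> u t + (g0 (u t) - g1 (u t))
        \<le> (grad_g1 (y t) + \<beta> t *\<^sub>R adjoint B (A (x (Suc t)) + B (y t) - c)) \<bullet> z + (g0 z - g1 z)"
      if "z \<in> \<Delta>" for t z
      using uArg(2)[OF that, of t] by (simp add: R)
    show "f1 w \<le> f1 v + grad_f1 v \<bullet> (w - v) + Mf / (\<mu> + 1) * norm (w - v) powr (\<mu> + 1)"
      if "v \<in> \<Xi>" "w \<in> \<Xi>" for v w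
      using that assms(23) by (simp add: f(1))
    show "g1 w \<le> g1 v + grad_g1 v \<bullet> (w - v) + Mg / (\<nu> + 1) * norm (w - v) powr (\<nu> + 1)"
      if "v \<in> \<Delta>" "w \<in> \<Delta>" for v w
      using that assms(24) by (simp add: g(1))
    show "u t \<in> \<Delta>" for t by (rule uArg(1))
    show "H (Suc t) = max (H 0) (2 * Mf / (\<mu> + 1)) * (real t + 1) powr (1 - \<mu>)" for t by fact
  qed (rule lin f(3) g(3) bdd xs ys xys x_mem y_mem \<beta> ystep \<omega>1 norm_linear_le_lambda_max[OF lin(1)] assms | blast)+

  \<comment> \<open>From the penalized objective to the distance to the solution set\<close>
  have \<beta>0: "0 < \<beta> 0" by fact
  \<comment> \<open>The constant that \<open>quadratic_root_le\<close> gives for the residual, with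
    leading coefficient \<open>\<beta> 0 / 4 * (t + 1) powr \<delta>\<close>.\<close>
  define Kf where "Kf = Cl * Cr / (\<beta> 0 / 4) + sqrt (K / (\<beta> 0 / 4))"
  define Ko where "Ko = K + Cl * Cr * Kf"
  have Kf: "0 \<le> Kf" using Cl(1) Cr(1) K \<beta>0 by (simp add: Kf_def)
  then have Ko: "0 \<le> Ko" using K Cl(1) Cr(1) by (simp add: Ko_def)
  define \<omega> where "\<omega> = min \<omega>1 \<omega>2"
  have \<omega>: "0 \<le> \<omega>" using \<omega>1 \<omega>2 by (simp add: \<omega>_def)
  have main: "infdist (x t, y t) (Argmin F)
      \<le> (Ce * Ko powr (1 - \<alpha>) + Cr * Kf) * (real t + 1) powr (- (1 - \<alpha>) * \<omega>)"
    if t: "t \<ge> 1" for t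
  proof -
    define z where "z = (x t, y t)"
    define \<rho> where "\<rho> = norm (L z - c)"
    have z: "z \<in> \<Xi> \<times> \<Delta>" using x_mem y_mem by (simp add: z_def)
    then obtain z' where z': "z' \<in> \<Xi> \<times> \<Delta>" "L z' = c" "norm (z - z') \<le> Cr * \<rho>"
      using Cr(2) unfolding \<rho>_def by blast
    then have z'D: "z' \<in> D" by (simp add: D_def)
    text \<open>Comparison with the feasible point \<open>z'\<close> bounds the objective at \<open>z\<close> below by
      \<open>m - Cl * Cr * \<rho>\<close>; this exact penalty bound replaces a Lagrange multiplier.\<close>
    have Clr: "\<phi> z' \<le> \<phi> z + Cl * Cr * \<rho>"
    proof -
      have "Cl * norm (z' - z) \<le> Cl * (Cr * \<rho>)"
        using z'(3) Cl(1) by (intro mult_left_mono) (auto simp: norm_minus_commute)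
      then show ?thesis using Cl(2)[OF z z'(1)] by simp
    qed
    have E: "\<phi> z + \<beta> 0 * real t powr \<delta> / 2 * \<rho>\<^sup>2 \<le> m + K * (real t + 1) powr (- \<omega>1)"
      using rate[OF t] by (simp add: \<phi>_def z_def m_def \<rho>_def L_def)
    \<comment> \<open>The base is shifted from \<open>t\<close> to \<open>t + 1\<close> at the price
      of a factor 2, since \<open>t + 1\<close> is at most \<open>2 * t\<close> and
      \<open>2 powr \<delta>\<close> is at most 2.\<close>
    have "\<beta> 0 / 4 * (real t + 1) powr \<delta> * \<rho>\<^sup>2 \<le> \<beta> 0 * real t powr \<delta> / 2 * \<rho>\<^sup>2"
    proof -
      have "(real t + 1) powr \<delta> \<le> (2 * real t) powr \<delta>"
        using t \<open>0 < \<delta>\<close> by (intro powr_mono2) auto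
      also have "\<dots> = 2 powr \<delta> * real t powr \<delta>" by (simp add: powr_mult)
      also have "\<dots> \<le> 2 powr 1 * real t powr \<delta>"
        using \<open>\<delta> < 1\<close> by (intro mult_right_mono powr_mono) auto
      finally have "\<beta> 0 / 4 * (real t + 1) powr \<delta> \<le> \<beta> 0 / 4 * (2 * real t powr \<delta>)"
        using \<beta>0 by (intro mult_left_mono) auto
      then show ?thesis by (intro mult_right_mono) auto
    qed
    then have "\<beta> 0 / 4 * (real t + 1) powr \<delta> * \<rho>\<^sup>2 \<le> Cl * Cr * \<rho> + K * (real t + 1) powr (- \<omega>1)"
      using E Clr m_le[OF z'D] by linarith
    then have "\<rho> \<le> Cl * Cr / (\<beta> 0 / 4 * (real t + 1) powr \<delta>)
        + sqrt (K * (real t + 1) powr (- \<omega>1) / (\<beta> 0 / 4 * (real t + 1) powr \<delta>))"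
      using Cl(1) Cr(1) K \<beta>0 by (intro quadratic_root_le) (auto simp: \<rho>_def)
    also have "Cl * Cr / (\<beta> 0 / 4 * (real t + 1) powr \<delta>)
        = Cl * Cr / (\<beta> 0 / 4) * (real t + 1) powr (- \<delta>)"
      by (simp add: powr_minus_divide)
    also have "K * (real t + 1) powr (- \<omega>1) / (\<beta> 0 / 4 * (real t + 1) powr \<delta>)
        = K / (\<beta> 0 / 4) * (real t + 1) powr (- (\<delta> + \<omega>1))"
      by (simp add: powr_minus_divide powr_add powr_diff)
    also have "sqrt \<dots> = sqrt (K / (\<beta> 0 / 4)) * (real t + 1) powr (- (\<delta> + \<omega>1) / 2)"
      by (simp add: real_sqrt_mult powr_half_sqrt[symmetric] powr_powr del: times_divide_eq_left)
    \<comment> \<open>Both decay exponents, \<open>\<delta>\<close> and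
      \<open>(\<delta> + \<omega>1) / 2\<close>, are at least \<open>\<omega>2\<close> and hence at
      least \<open>\<omega>\<close>.\<close>
    also have "Cl * Cr / (\<beta> 0 / 4) * (real t + 1) powr (- \<delta>) + \<dots>
        \<le> Cl * Cr / (\<beta> 0 / 4) * (real t + 1) powr (- \<omega>)
          + sqrt (K / (\<beta> 0 / 4)) * (real t + 1) powr (- \<omega>)"
      using \<omega>2 Cl(1) Cr(1) K \<beta>0 by (intro add_mono mult_left_mono powr_mono) (auto simp: \<omega>_def)
    finally have \<rho>: "\<rho> \<le> Kf * (real t + 1) powr (- \<omega>)" by (simp add: Kf_def distrib_right)
    have "\<phi> z \<le> m + K * (real t + 1) powr (- \<omega>1)"
    proof -
      have "0 \<le> \<beta> 0 * real t powr \<delta> / 2 * \<rho>\<^sup>2" using \<beta>0 by simp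
      then show ?thesis using E by linarith
    qed
    also have "K * (real t + 1) powr (- \<omega>1) \<le> K * (real t + 1) powr (- \<omega>)"
      using K by (intro mult_left_mono powr_mono) (auto simp: \<omega>_def)
    finally have "\<phi> z' - m \<le> K * (real t + 1) powr (- \<omega>) + Cl * Cr * \<rho>" using Clr by simp
    also have "Cl * Cr * \<rho> \<le> Cl * Cr * (Kf * (real t + 1) powr (- \<omega>))"
      using \<rho> Cl(1) Cr(1) by (intro mult_left_mono) auto
    finally have gap: "\<phi> z' - m \<le> Ko * (real t + 1) powr (- \<omega>)" by (simp add: Ko_def distrib_right)
    have "infdist z (Argmin F) \<le> infdist z' (Argmin F) + dist z z'" by (rule infdist_triangle)
    also have "infdist z' (Argmin F) \<le> Ce * (\<phi> z' - m) powr (1 - \<alpha>)" by (rule Ce(2)[OF z'D])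
    also have "\<dots> \<le> Ce * (Ko * (real t + 1) powr (- \<omega>)) powr (1 - \<alpha>)"
      using gap m_le[OF z'D] \<open>\<alpha> < 1\<close> Ce(1) by (intro mult_left_mono powr_mono2) auto
    also have "(Ko * (real t + 1) powr (- \<omega>)) powr (1 - \<alpha>)
        = Ko powr (1 - \<alpha>) * (real t + 1) powr (- (1 - \<alpha>) * \<omega>)"
      using Ko by (simp add: powr_mult powr_powr algebra_simps)
    also have "dist z z' \<le> Cr * (Kf * (real t + 1) powr (- \<omega>))"
      using z'(3) mult_left_mono[OF \<rho> Cr(1)] by (simp add: dist_norm)
    \<comment> \<open>As \<open>\<alpha> \<ge> 0\<close> and the base is at least 1, the move to the
      feasible point \<open>z'\<close> is no larger in order than the KL term.\<close>
    also have "\<dots> \<le> Cr * (Kf * (real t + 1) powr (- (1 - \<alpha>) * \<omega>))"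
      using Cr(1) Kf \<omega> \<open>0 \<le> \<alpha>\<close> by (intro mult_left_mono powr_mono) (auto simp: algebra_simps)
    finally show ?thesis by (simp add: z_def algebra_simps)
  qed
  show ?thesis
  proof (rule bigoI)
    show "\<forall>\<^sub>F t in sequentially. norm (infdist (x t, y t) (Argmin F))
        \<le> (Ce * Ko powr (1 - \<alpha>) + Cr * Kf) * norm ((real t + 1) powr (- (1 - \<alpha>) * min \<omega>1 \<omega>2))"
      using eventually_ge_at_top[of 1] by eventually_elim (use main in \<open>simp add: infdist_nonneg \<omega>_def\<close>)
  qed
qed

end
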